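(* Let $M$ be a compact orbifold equipped with a finite triangulation, let $P$ be the poset of simplices of the triangulation ordered by inclusion, and let $G: P^{\mathrm{op}} \to \mathbf{Cat}$ be the resulting complex of finite groups. Then the Euler characteristic $\chi(\mathbb{E}(G))$ of the category of elements $\mathbb{E}(G)$ is defined and equal to the orbifold Euler characteristic $\chi(M)$.
   Context: Triangulated orbifolds. A finite triangulation of a compact orbifold $M$ is a triangulation of its underlying space by a finite simplicial complex, compatible with the orbifold structure: each (closed) simplex $p$ lies in an orbifold chart $\tilde U \to \tilde U/\Gamma$ ($\Gamma$ a finite group), lifts to a continuous $\tilde p \subseteq \tilde U$, and the isotropy group is constant (up to isomorphism) along the interior of $p$. The (nonempty) simplices, ordered by inclusion, form a finite poset $P$. If $p \in P$ is a $d$-dimensional simplex then $\{q \in P : q \leq p\}$ is isomorphic to the poset of nonempty subsets of $\{1, \ldots, d+1\}$ ordered by inclusion, with $p$ corresponding to $\{1, \ldots, d+1\}$. Each $p \in P$ has a finite stabilizer group $G(p)$, the pointwise stabilizer of $\tilde p$ in $\Gamma$ (equivalently the isotropy group of an interior point of $p$). The orbifold Euler characteristic is $$\chi(M) = \sum_{p \in P} (-1)^{\dim p} / |G(p)|.$$ Complex of groups. A complex of finite groups on $P^{\mathrm{op}}$ is a weak functor (pseudofunctor) $G: P^{\mathrm{op}} \to \mathbf{Cat}$ whose values on objects are finite groups (regarded as one-object categories) and whose values on arrows are injective homomorphisms. The stabilizer groups $G(p)$ form such a complex: for $q \leq p$, the homomorphism $G(p) \to G(q)$ sends an element stabilizing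 $\tilde p$ pointwise to the corresponding element stabilizing the face of $\tilde p$ over $q$, followed by the identification (by a chosen arrow of the orbifold, hence well defined up to conjugation) of the pointwise stabilizer of that face with the pointwise stabilizer $G(q)$ of the chosen lift $\tilde q$; the conjugations give the coherence isomorphisms of the weak functor. Category of elements. For a weak functor $X: \mathbb{A} \to \mathbf{Cat}$, $\mathbb{E}(X)$ has as objects the pairs $(a,x)$ with $a \in \mathbb{A}$, $x \in Xa$; maps $(a,x) \to (a',x')$ are pairs $(f,\xi)$ with $f: a \to a'$ in $\mathbb{A}$ and $\xi: (Xf)(x) \to x'$ in $Xa'$. Here it is applied with $\mathbb{A} = P^{\mathrm{op}}$, where a poset is viewed as a category with a unique arrow $a \to b$ if $a \leq b$ and none otherwise. Euler characteristic of a category. For a finite category $\mathbb{A}$, a weighting is a function $k^\bullet: \mathrm{ob}\,\mathbb{A} \to \mathbb{Q}$ such that $\sum_{b} |\mathbb{A}(a,b)|\, k^b = 1$ for all $a$; a coweighting $k_\bullet$ is a weighting on $\mathbb{A}^{\mathrm{op}}$. $\mathbb{A}$ has Euler characteristic ($\chi(\mathbb{A})$ is defined) if it admits both a weighting and a coweighting; then $\chi(\mathbb{A}) = \sum_a k^a = \sum_a k_a \in \mathbb{Q}$ for any weighting and coweighting (the two sums agree and do not depend on the choices). *)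

theory Defs
  imports "HOL-Analysis.Analysis" "HOL-Algebra.Coset"
begin

section \<open>Categories and their Euler characteristic\<close>

text \<open>Hom-sets are indexed by their end points and need not be disjoint; \<open>Comp C a b c g f\<close> is
  the composite of \<open>f : a \<rightarrow> b\<close> followed by \<open>g : b \<rightarrow> c\<close>.\<close>

record ('o, 'm) cat =
  Ob :: "'o set"
  Hom :: "'o \<Rightarrow> 'o \<Rightarrow> 'm set"
  Id :: "'o \<Rightarrow> 'm"
  Comp :: "'o \<Rightarrow> 'o \<Rightarrow> 'o \<Rightarrow> 'm \<Rightarrow> 'm \<Rightarrow> 'm"

locale category =
  fixes C :: "('o, 'm) cat"
  assumes Id_in: "a \<in> Ob C \<Longrightarrow> Id C a \<in> Hom C a a"
    and Comp_in: "\<lbrakk>a \<in> Ob C; b \<in> Ob C; c \<in> Ob C; f \<in> Hom C a b; g \<in> Hom C b c\<rbrakk>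
      \<Longrightarrow> Comp C a b c g f \<in> Hom C a c"
    and Comp_Id_right: "\<lbrakk>a \<in> Ob C; b \<in> Ob C; f \<in> Hom C a b\<rbrakk> \<Longrightarrow> Comp C a a b f (Id C a) = f"
    and Comp_Id_left: "\<lbrakk>a \<in> Ob C; b \<in> Ob C; f \<in> Hom C a b\<rbrakk> \<Longrightarrow> Comp C a b b (Id C b) f = f"
    and Comp_assoc: "\<lbrakk>a \<in> Ob C; b \<in> Ob C; c \<in> Ob C; d \<in> Ob C;
        f \<in> Hom C a b; g \<in> Hom C b c; h \<in> Hom C c d\<rbrakk>
      \<Longrightarrow> Comp C a c d h (Comp C a b c g f) = Comp C a b d (Comp C b c d h g) f"

definition op_cat :: "('o, 'm) cat \<Rightarrow> ('o, 'm) cat" where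
  "op_cat C = \<lparr>Ob = Ob C, Hom = (\<lambda>a b. Hom C b a), Id = Id C,
     Comp = (\<lambda>a b c g f. Comp C c b a f g)\<rparr>"

definition poset_cat :: "'a set \<Rightarrow> ('a \<Rightarrow> 'a \<Rightarrow> bool) \<Rightarrow> ('a, unit) cat" where
  "poset_cat P below = \<lparr>Ob = P, Hom = (\<lambda>a b. if below a b then {()} else {}), Id = (\<lambda>_. ()),
     Comp = (\<lambda>_ _ _ _ _. ())\<rparr>"

definition group_cat :: "('g, 'b) monoid_scheme \<Rightarrow> (unit, 'g) cat" where
  "group_cat H = \<lparr>Ob = {()}, Hom = (\<lambda>_ _. carrier H), Id = (\<lambda>_. \<one>\<^bsub>H\<^esub>),
     Comp = (\<lambda>_ _ _ g f. g \<otimes>\<^bsub>H\<^esub> f)\<rparr>"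

definition finite_category :: "('o, 'm) cat \<Rightarrow> bool" where
  "finite_category C \<longleftrightarrow> category C \<and> finite (Ob C) \<and>
    (\<forall>a\<in>Ob C. \<forall>b\<in>Ob C. finite (Hom C a b))"

definition weighting :: "('o, 'm) cat \<Rightarrow> ('o \<Rightarrow> rat) \<Rightarrow> bool" where
  "weighting C k \<longleftrightarrow> (\<forall>a\<in>Ob C. (\<Sum>b\<in>Ob C. of_nat (card (Hom C a b)) * k b) = 1)"

definition coweighting :: "('o, 'm) cat \<Rightarrow> ('o \<Rightarrow> rat) \<Rightarrow> bool" where
  "coweighting C k \<longleftrightarrow> weighting (op_cat C) k"

definition has_euler_char :: "('o, 'm) cat \<Rightarrow> bool" where
  "has_euler_char C \<longleftrightarrow> finite_category C \<and> (\<exists>k. weighting C k) \<and> (\<exists>k. coweighting C k)"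

text \<open>Meaningful only under \<^const>\<open>has_euler_char\<close>, when the sum is the same for all weightings and
  all coweightings.\<close>

definition euler_char :: "('o, 'm) cat \<Rightarrow> rat" where
  "euler_char C = (\<Sum>a\<in>Ob C. (SOME k. weighting C k) a)"


section \<open>Weak functors into Cat and their categories of elements\<close>

text \<open>The coherence isomorphisms are oriented as
  \<open>coh_comp X a b c g f x : X(g f) x \<rightarrow> X g (X f x)\<close> for \<open>f : a \<rightarrow> b\<close>, \<open>g : b \<rightarrow> c\<close>, and \<open>coh_id X a x : X(1\<^sub>a) x \<rightarrow> x\<close>, which is what composition
  and identities in the category of elements use. They are required to be invertible, so this is
  the usual notion of a pseudofunctor.\<close>

record ('a, 'f, 'o, 'm) cat_valued =
  val :: "'a \<Rightarrow> ('o, 'm) cat"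
  act_ob :: "'a \<Rightarrow> 'a \<Rightarrow> 'f \<Rightarrow> 'o \<Rightarrow> 'o"
  act_mor :: "'a \<Rightarrow> 'a \<Rightarrow> 'f \<Rightarrow> 'o \<Rightarrow> 'o \<Rightarrow> 'm \<Rightarrow> 'm"
  coh_comp :: "'a \<Rightarrow> 'a \<Rightarrow> 'a \<Rightarrow> 'f \<Rightarrow> 'f \<Rightarrow> 'o \<Rightarrow> 'm"
  coh_id :: "'a \<Rightarrow> 'o \<Rightarrow> 'm"

definition is_functor ::
  "('o, 'm) cat \<Rightarrow> ('p, 'n) cat \<Rightarrow> ('o \<Rightarrow> 'p) \<Rightarrow> ('o \<Rightarrow> 'o \<Rightarrow> 'm \<Rightarrow> 'n) \<Rightarrow> bool" where
  "is_functor C D F\<^sub>o F\<^sub>m \<longleftrightarrow>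
     (\<forall>x\<in>Ob C. F\<^sub>o x \<in> Ob D) \<and>
     (\<forall>x\<in>Ob C. \<forall>y\<in>Ob C. \<forall>h\<in>Hom C x y. F\<^sub>m x y h \<in> Hom D (F\<^sub>o x) (F\<^sub>o y)) \<and>
     (\<forall>x\<in>Ob C. F\<^sub>m x x (Id C x) = Id D (F\<^sub>o x)) \<and>
     (\<forall>x\<in>Ob C. \<forall>y\<in>Ob C. \<forall>z\<in>Ob C. \<forall>h\<in>Hom C x y. \<forall>k\<in>Hom C y z.
        F\<^sub>m x z (Comp C x y z k h) = Comp D (F\<^sub>o x) (F\<^sub>o y) (F\<^sub>o z) (F\<^sub>m y z k) (F\<^sub>m x y h))"

definition iso_in :: "('o, 'm) cat \<Rightarrow> 'o \<Rightarrow> 'o \<Rightarrow> 'm \<Rightarrow> bool" where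
  "iso_in C x y h \<longleftrightarrow> h \<in> Hom C x y \<and>
     (\<exists>k\<in>Hom C y x. Comp C x y x k h = Id C x \<and> Comp C y x y h k = Id C y)"

locale weak_functor = category A for A :: "('a, 'f) cat" +
  fixes X :: "('a, 'f, 'o, 'm) cat_valued"
  assumes val_category: "a \<in> Ob A \<Longrightarrow> category (val X a)"
    and act_functor: "\<lbrakk>a \<in> Ob A; b \<in> Ob A; f \<in> Hom A a b\<rbrakk>
      \<Longrightarrow> is_functor (val X a) (val X b) (act_ob X a b f) (act_mor X a b f)"
    and coh_comp_iso: "\<lbrakk>a \<in> Ob A; b \<in> Ob A; c \<in> Ob A; f \<in> Hom A a b; g \<in> Hom A b c;
        x \<in> Ob (val X a)\<rbrakk>
      \<Longrightarrow> iso_in (val X c) (act_ob X a c (Comp A a b c g f) x)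
            (act_ob X b c g (act_ob X a b f x)) (coh_comp X a b c g f x)"
    and coh_comp_natural: "\<lbrakk>a \<in> Ob A; b \<in> Ob A; c \<in> Ob A; f \<in> Hom A a b; g \<in> Hom A b c;
        x \<in> Ob (val X a); y \<in> Ob (val X a); \<xi> \<in> Hom (val X a) x y\<rbrakk>
      \<Longrightarrow> Comp (val X c) (act_ob X a c (Comp A a b c g f) x)
            (act_ob X a c (Comp A a b c g f) y) (act_ob X b c g (act_ob X a b f y))
            (coh_comp X a b c g f y) (act_mor X a c (Comp A a b c g f) x y \<xi>)
        = Comp (val X c) (act_ob X a c (Comp A a b c g f) x)
            (act_ob X b c g (act_ob X a b f x)) (act_ob X b c g (act_ob X a b f y))
            (act_mor X b c g (act_ob X a b f x) (act_ob X a b f y) (act_mor X a b f x y \<xi>))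
            (coh_comp X a b c g f x)"
    and coh_id_iso: "\<lbrakk>a \<in> Ob A; x \<in> Ob (val X a)\<rbrakk>
      \<Longrightarrow> iso_in (val X a) (act_ob X a a (Id A a) x) x (coh_id X a x)"
    and coh_id_natural: "\<lbrakk>a \<in> Ob A; x \<in> Ob (val X a); y \<in> Ob (val X a); \<xi> \<in> Hom (val X a) x y\<rbrakk>
      \<Longrightarrow> Comp (val X a) (act_ob X a a (Id A a) x) (act_ob X a a (Id A a) y) y
            (coh_id X a y) (act_mor X a a (Id A a) x y \<xi>)
        = Comp (val X a) (act_ob X a a (Id A a) x) x y \<xi> (coh_id X a x)"
    and coh_assoc: "\<lbrakk>a \<in> Ob A; b \<in> Ob A; c \<in> Ob A; d \<in> Ob A;
        f \<in> Hom A a b; g \<in> Hom A b c; h \<in> Hom A c d; x \<in> Ob (val X a)\<rbrakk>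
      \<Longrightarrow> Comp (val X d) (act_ob X a d (Comp A a b d (Comp A b c d h g) f) x)
            (act_ob X b d (Comp A b c d h g) (act_ob X a b f x))
            (act_ob X c d h (act_ob X b c g (act_ob X a b f x)))
            (coh_comp X b c d h g (act_ob X a b f x))
            (coh_comp X a b d (Comp A b c d h g) f x)
        = Comp (val X d) (act_ob X a d (Comp A a c d h (Comp A a b c g f)) x)
            (act_ob X c d h (act_ob X a c (Comp A a b c g f) x))
            (act_ob X c d h (act_ob X b c g (act_ob X a b f x)))
            (act_mor X c d h (act_ob X a c (Comp A a b c g f) x)
               (act_ob X b c g (act_ob X a b f x)) (coh_comp X a b c g f x))
            (coh_comp X a c d h (Comp A a b c g f) x)"
    and coh_unit_right: "\<lbrakk>a \<in> Ob A; b \<in> Ob A; f \<in> Hom A a b; x \<in> Ob (val X a)\<rbrakk>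
      \<Longrightarrow> Comp (val X b) (act_ob X a b (Comp A a a b f (Id A a)) x)
            (act_ob X a b f (act_ob X a a (Id A a) x)) (act_ob X a b f x)
            (act_mor X a b f (act_ob X a a (Id A a) x) x (coh_id X a x))
            (coh_comp X a a b f (Id A a) x)
        = Id (val X b) (act_ob X a b f x)"
    and coh_unit_left: "\<lbrakk>a \<in> Ob A; b \<in> Ob A; f \<in> Hom A a b; x \<in> Ob (val X a)\<rbrakk>
      \<Longrightarrow> Comp (val X b) (act_ob X a b (Comp A a b b (Id A b) f) x)
            (act_ob X b b (Id A b) (act_ob X a b f x)) (act_ob X a b f x)
            (coh_id X b (act_ob X a b f x)) (coh_comp X a b b (Id A b) f x)
        = Id (val X b) (act_ob X a b f x)"

definition elements ::
  "('a, 'f) cat \<Rightarrow> ('a, 'f, 'o, 'm) cat_valued \<Rightarrow> ('a \<times> 'o, 'f \<times> 'm) cat" where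
  "elements A X = \<lparr>
     Ob = {(a, x). a \<in> Ob A \<and> x \<in> Ob (val X a)},
     Hom = (\<lambda>(a, x) (b, y). {(f, \<xi>). f \<in> Hom A a b \<and> \<xi> \<in> Hom (val X b) (act_ob X a b f x) y}),
     Id = (\<lambda>(a, x). (Id A a, coh_id X a x)),
     Comp = (\<lambda>(a, x) (b, y) (c, z) (g, \<zeta>) (f, \<xi>).
       (Comp A a b c g f,
        Comp (val X c) (act_ob X a c (Comp A a b c g f) x) (act_ob X b c g y) z \<zeta>
          (Comp (val X c) (act_ob X a c (Comp A a b c g f) x)
             (act_ob X b c g (act_ob X a b f x)) (act_ob X b c g y)
             (act_mor X b c g (act_ob X a b f x) y \<xi>) (coh_comp X a b c g f x))))\<rparr>"

lemma elements_simps: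
  "Ob (elements A X) = {(a, x). a \<in> Ob A \<and> x \<in> Ob (val X a)}"
  "Hom (elements A X) (a,x) (b,y) = {(f, \<xi>). f \<in> Hom A a b \<and> \<xi> \<in> Hom (val X b) (act_ob X a b f
      x) y}"
  "Id (elements A X) (a,x) = (Id A a, coh_id X a x)"
  "Comp (elements A X) (a,x) (b,y) (c,z) (g,\<zeta>) (f,\<xi>) =
     (Comp A a b c g f,
        Comp (val X c) (act_ob X a c (Comp A a b c g f) x) (act_ob X b c g y) z \<zeta>
          (Comp (val X c) (act_ob X a c (Comp A a b c g f) x)
             (act_ob X b c g (act_ob X a b f x)) (act_ob X b c g y)
             (act_mor X b c g (act_ob X a b f x) y \<xi>) (coh_comp X a b c g f x)))"
  by (simp_all add: elements_def)

context weak_functor begin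

lemma act_ob_in: "\<lbrakk>a \<in> Ob A; b \<in> Ob A; f \<in> Hom A a b; x \<in> Ob (val X a)\<rbrakk> \<Longrightarrow> act_ob X a b f x \<in> Ob
    (val X b)"
  using act_functor unfolding is_functor_def by blast

lemma act_mor_in: "\<lbrakk>a \<in> Ob A; b \<in> Ob A; f \<in> Hom A a b; x \<in> Ob (val X a); y \<in> Ob (val X a);
   \<xi> \<in> Hom (val X a) x y\<rbrakk> \<Longrightarrow> act_mor X a b f x y \<xi> \<in> Hom
     (val X b) (act_ob X a b f x) (act_ob X a b f y)"
  using act_functor unfolding is_functor_def by blast

lemma act_mor_Id: "\<lbrakk>a \<in> Ob A; b \<in> Ob A; f \<in> Hom A a b; x \<in> Ob (val X a)\<rbrakk> \<Longrightarrow>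
   act_mor X a b f x x (Id (val X a) x) = Id (val X b) (act_ob X a b f x)"
  using act_functor unfolding is_functor_def by blast

lemma act_mor_Comp: "\<lbrakk>a \<in> Ob A; b \<in> Ob A; f \<in> Hom A a b; x \<in> Ob (val X a);
  y \<in> Ob (val X a); z \<in> Ob (val X a);
   \<xi> \<in> Hom (val X a) x y; \<zeta> \<in> Hom (val X a) y z\<rbrakk> \<Longrightarrow>
   act_mor X a b f x z (Comp (val X a) x y z \<zeta> \<xi>) =
   Comp (val X b) (act_ob X a b f x) (act_ob X a b f y) (act_ob X a b f z) (act_mor X a b f y z
       \<zeta>) (act_mor X a b f x y \<xi>)"
  using act_functor unfolding is_functor_def by blast

lemma coh_comp_in: "\<lbrakk>a \<in> Ob A; b \<in> Ob A; c \<in> Ob A; f \<in> Hom A a b; g \<in> Hom A b c;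
        x \<in> Ob (val X a)\<rbrakk>
      \<Longrightarrow> coh_comp X a b c g f x \<in> Hom (val X c) (act_ob X a c (Comp A a b c g f) x)
            (act_ob X b c g (act_ob X a b f x))"
  using coh_comp_iso unfolding iso_in_def by blast

lemma coh_id_in: "\<lbrakk>a \<in> Ob A; x \<in> Ob (val X a)\<rbrakk>
      \<Longrightarrow> coh_id X a x \<in> Hom (val X a) (act_ob X a a (Id A a) x) x"
  using coh_id_iso unfolding iso_in_def by blast

lemmas vc = category.Id_in[OF val_category] category.Comp_in[OF val_category]
 act_ob_in act_mor_in coh_comp_in coh_id_in Id_in Comp_in

theorem category_elements: "category (elements A X)"
proof
  fix p assume "p \<in> Ob (elements A X)"
  then show "Id (elements A X) p \<in> Hom (elements A X) p p"
    by (cases p) (simp add: elements_simps vc)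
next
  fix p q r f g
  assume "p \<in> Ob (elements A X)" "q \<in> Ob (elements A X)" "r \<in> Ob (elements A X)"
   "f \<in> Hom (elements A X) p q" "g \<in> Hom (elements A X) q r"
  then show "Comp (elements A X) p q r g f \<in> Hom (elements A X) p r"
    by (cases p; cases q; cases r; cases f; cases g) (auto simp: elements_simps intro!: vc)
next
  fix p q F
  assume "p \<in> Ob (elements A X)" "q \<in> Ob (elements A X)" "F \<in> Hom (elements A X) p q"
  moreover obtain a x b y f \<xi> where [simp]: "p = (a,x)" "q = (b,y)" "F = (f,\<xi>)"
    by (metis surj_pair)
  ultimately have h: "a \<in> Ob A" "x \<in> Ob (val X a)" "b \<in> Ob A" "y \<in> Ob (val X b)" "f \<in> Hom A a b"
    "\<xi> \<in> Hom (val X b) (act_ob X a b f x) y" by (auto simp: elements_simps)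
  have c: "Comp A a a b f (Id A a) = f" "Comp A a b b (Id A b) f = f"
    using h Comp_Id_right Comp_Id_left by auto
  show "Comp (elements A X) p p q F (Id (elements A X) p) = F"
    using coh_unit_right[of a b f x] h
    by (simp add: elements_simps c category.Comp_Id_right[OF val_category] vc)
  let ?x = "act_ob X a b f x"
  let ?o = "act_ob X b b (Id A b) ?x"
  have v: "category (val X b)" using h val_category by blast
  have o: "?x \<in> Ob (val X b)" "?o \<in> Ob (val X b)" "act_ob X b b (Id A b) y \<in> Ob (val X b)" using
      h by (auto intro!: vc)
  have i: "coh_comp X a b b (Id A b) f x \<in> Hom (val X b) ?x ?o"
    using coh_comp_in[of a b b f "Id A b" x] h Id_in by (simp add: c)
  show "Comp (elements A X) p q q (Id (elements A X) q) F = F"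
    apply (simp add: elements_simps c)
    apply (subst category.Comp_assoc[OF v])
    using h o i apply (auto intro!: vc)[7]
    apply (subst coh_id_natural)
    using h o i apply (auto intro!: vc)[4]
    apply (subst category.Comp_assoc[OF v, symmetric])
    using h o i apply (auto intro!: vc)[7]
    using coh_unit_left[of a b f x] h o by (simp add: c category.Comp_Id_right[OF v])
next
  fix p q r s F G H
  assume "p \<in> Ob (elements A X)" "q \<in> Ob (elements A X)" "r \<in> Ob (elements A X)" "s \<in> Ob
      (elements A X)"
   "F \<in> Hom (elements A X) p q" "G \<in> Hom (elements A X) q r" "H \<in> Hom (elements A X) r s"
  moreover obtain a x b y c z d w f \<xi> g \<zeta> h \<eta> where [simp]: "p = (a,x)" "q = (b,y)" "r = (c,z)"
      "s = (d,w)"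
     "F = (f,\<xi>)" "G = (g,\<zeta>)" "H = (h,\<eta>)"
    by (metis surj_pair)
  ultimately have H: "a \<in> Ob A" "x \<in> Ob (val X a)" "b \<in> Ob A" "y \<in> Ob (val X b)" "c \<in> Ob A" "z \<in>
      Ob (val X c)"
    "d \<in> Ob A" "w \<in> Ob (val X d)" "f \<in> Hom A a b" "g \<in> Hom A b c" "h \<in> Hom A c d"
    "\<xi> \<in> Hom (val X b) (act_ob X a b f x) y" "\<zeta> \<in> Hom (val X c) (act_ob X b c g y) z"
    "\<eta> \<in> Hom (val X d) (act_ob X c d h z) w" by (auto simp: elements_simps)
  define gf hg hgf where "gf = Comp A a b c g f" and "hg = Comp A b c d h g" and "hgf = Comp A a
      c d h gf"
  have a: "Comp A a b d hg f = hgf" unfolding hg_def hgf_def gf_def using H Comp_assoc by simp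
  have hs: "gf \<in> Hom A a c" "hg \<in> Hom A b d" "hgf \<in> Hom A a d"
    unfolding hg_def hgf_def gf_def using H by (auto intro!: vc)
  define x' where "x' = act_ob X a b f x"
  define o1 o2 o3 o4 o5 p' q' where os: "o1 = act_ob X a d hgf x" "o2 = act_ob X c d h (act_ob X
      a c gf x)"
    "o3 = act_ob X c d h (act_ob X b c g x')" "o4 = act_ob X c d h (act_ob X b c g y)"
    "o5 = act_ob X c d h z" "p' = act_ob X b d hg x'" "q' = act_ob X b d hg y"
  let ?V = "val X d"
  have x': "x' \<in> Ob (val X b)" unfolding x'_def using H vc by blast
  have O: "o1 \<in> Ob ?V" "o2 \<in> Ob ?V" "o3 \<in> Ob ?V" "o4 \<in> Ob ?V" "o5 \<in> Ob ?V" "p' \<in> Ob ?V" "q' \<in> Ob ?V"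
    unfolding os using H hs x' by (auto intro!: vc)
  define u v m k m' e e' t where as: "u = coh_comp X a c d h gf x"
    "v = act_mor X c d h (act_ob X a c gf x) (act_ob X b c g x') (coh_comp X a b c g f x)"
    "m = act_mor X c d h (act_ob X b c g x') (act_ob X b c g y) (act_mor X b c g x' y \<xi>)"
    "k = act_mor X c d h (act_ob X b c g y) z \<zeta>"
    "m' = act_mor X b d hg x' y \<xi>" "e = coh_comp X b c d h g y" "e' = coh_comp X b c d h g x'"
    "t = coh_comp X a b d hg f x"
  have I: "u \<in> Hom ?V o1 o2" "v \<in> Hom ?V o2 o3" "m \<in> Hom ?V o3 o4" "k \<in> Hom ?V o4 o5" "\<eta> \<in> Hom
      ?V o5 w"
     "m' \<in> Hom ?V p' q'" "e \<in> Hom ?V q' o4" "e' \<in> Hom ?V p' o3" "t \<in> Hom ?V o1 p'"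
    unfolding as os using H hs x' a coh_comp_in[of a c d gf h x] coh_comp_in[of a b c f g x]
        coh_comp_in[of b c d g h y]
       coh_comp_in[of b c d g h x'] coh_comp_in[of a b d f hg x]
    by (auto intro!: vc simp: hgf_def[symmetric] gf_def[symmetric] x'_def[symmetric]
        hg_def[symmetric])
  have vd: "category ?V" using H val_category by blast
  have n: "Comp ?V p' q' o4 e m' = Comp ?V p' o3 o4 m e'"
    unfolding as os hg_def using coh_comp_natural[of b c d g h x' y \<xi>] H x' by (simp add: x'_def)
  have as2: "Comp ?V o1 p' o3 e' t = Comp ?V o1 o2 o3 v u"
    using coh_assoc[of a b c d f g h x] H
    by (simp add: as os hgf_def[symmetric] gf_def[symmetric] x'_def[symmetric] hg_def[symmetric] a)
  have L: "Comp (elements A X) p r s H (Comp (elements A X) p q r G F) =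
    (hgf, Comp ?V o1 o5 w \<eta> (Comp ?V o1 o2 o5 (Comp ?V o2 o4 o5 k (Comp ?V o2 o3 o4 m v)) u))"
    using H x' hs coh_comp_in[of a b c f g x]
    apply (simp add: elements_simps hgf_def[symmetric] gf_def[symmetric] x'_def[symmetric]
        hg_def[symmetric] as os)
    by (subst act_mor_Comp act_mor_Comp[symmetric]; (auto intro!: vc)?)+
  have R: "Comp (elements A X) p q s (Comp (elements A X) q r s H G) F =
    (hgf, Comp ?V o1 q' w (Comp ?V q' o5 w \<eta> (Comp ?V q' o4 o5 k e)) (Comp ?V o1 p' q' m' t))"
    using H x' hs
    by (simp add: elements_simps hgf_def[symmetric] gf_def[symmetric] x'_def[symmetric]
        hg_def[symmetric] as os a)
  note ca = category.Comp_assoc[OF vd]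
  note ci = category.Comp_in[OF vd]
  have "Comp ?V o1 q' w (Comp ?V q' o5 w \<eta> (Comp ?V q' o4 o5 k e)) (Comp ?V o1 p' q' m' t)
     = Comp ?V o1 o5 w \<eta> (Comp ?V o1 q' o5 (Comp ?V q' o4 o5 k e) (Comp ?V o1 p' q' m' t))"
    by (rule ca[symmetric]) (use O I H in \<open>auto intro!: ci\<close>)
  also have "Comp ?V o1 q' o5 (Comp ?V q' o4 o5 k e) (Comp ?V o1 p' q' m' t)
     = Comp ?V o1 o4 o5 k (Comp ?V o1 q' o4 e (Comp ?V o1 p' q' m' t))"
    by (rule ca[symmetric]) (use O I H in \<open>auto intro!: ci\<close>)
  also have "Comp ?V o1 q' o4 e (Comp ?V o1 p' q' m' t) = Comp ?V o1 p' o4 (Comp ?V p' q' o4 e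
      m') t"
    by (rule ca) (use O I H in \<open>auto intro!: ci\<close>)
  also have "\<dots> = Comp ?V o1 o3 o4 m (Comp ?V o1 p' o3 e' t)" unfolding n
    by (rule ca[symmetric]) (use O I H in \<open>auto intro!: ci\<close>)
  also have "\<dots> = Comp ?V o1 o2 o4 (Comp ?V o2 o3 o4 m v) u" unfolding as2
    by (rule ca) (use O I H in \<open>auto intro!: ci\<close>)
  also have "Comp ?V o1 o4 o5 k \<dots> = Comp ?V o1 o2 o5 (Comp ?V o2 o4 o5 k (Comp ?V o2 o3 o4 m v)) u"
    by (rule ca) (use O I H in \<open>auto intro!: ci\<close>)
  finally show "Comp (elements A X) p r s H (Comp (elements A X) p q r G F) =
     Comp (elements A X) p q s (Comp (elements A X) q r s H G) F"
    unfolding L R by simp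
qed
end

definition complex_of_finite_groups ::
  "'a set \<Rightarrow> ('a \<Rightarrow> 'a \<Rightarrow> bool) \<Rightarrow> ('a, unit, unit, 'g) cat_valued \<Rightarrow> bool" where
  "complex_of_finite_groups P below X \<longleftrightarrow>
     weak_functor (op_cat (poset_cat P below)) X \<and>
     (\<forall>p\<in>P. \<exists>H :: 'g monoid. group H \<and> finite (carrier H) \<and> val X p = group_cat H) \<and>
     (\<forall>p\<in>P. \<forall>q\<in>P. below q p \<longrightarrow>
        inj_on (act_mor X p q () () ()) (Hom (val X p) () ()))"


section \<open>Orbifolds\<close>

text \<open>An orbifold of dimension \<open>n\<close> with underlying space \<open>M\<close> is presented by a proper etale Lie
  groupoid whose orbit space is identified with \<open>M\<close> (so orbifolds need not be effective).
  Smoothness is calculus on open subsets \<open>S\<close> of \<^term>\<open>Euclidean_space n\<close>, whose points are the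
  sequences vanishing from index \<open>n\<close> on; the case \<open>n = 0\<close> is included.\<close>

primrec Ck :: "nat \<Rightarrow> nat \<Rightarrow> (nat \<Rightarrow> real) set \<Rightarrow> ((nat \<Rightarrow> real) \<Rightarrow> real) \<Rightarrow> bool" where
  "Ck n 0 S f \<longleftrightarrow> continuous_map (subtopology (Euclidean_space n) S) euclideanreal f"
| "Ck n (Suc k) S f \<longleftrightarrow> continuous_map (subtopology (Euclidean_space n) S) euclideanreal f \<and>
     (\<forall>i<n. \<exists>f'. (\<forall>x\<in>S. ((\<lambda>t. f (x(i := t))) has_real_derivative f' x) (at (x i))) \<and> Ck n k S f')"

definition smooth_map :: "nat \<Rightarrow> (nat \<Rightarrow> real) set \<Rightarrow> ((nat \<Rightarrow> real) \<Rightarrow> (nat \<Rightarrow> real)) \<Rightarrow> bool" where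
  "smooth_map n S F \<longleftrightarrow> (\<forall>i<n. \<forall>k. Ck n k S (\<lambda>x. F x i))"

definition smooth_in_charts ::
  "nat \<Rightarrow> ('o set \<times> ('o \<Rightarrow> nat \<Rightarrow> real)) set \<Rightarrow> 'o set \<Rightarrow> ('o \<Rightarrow> 'o) \<Rightarrow> bool" where
  "smooth_in_charts n \<A> D F \<longleftrightarrow> (\<forall>(U, \<phi>)\<in>\<A>. \<forall>(V, \<psi>)\<in>\<A>.
     smooth_map n (\<phi> ` {x \<in> D \<inter> U. F x \<in> V}) (\<psi> \<circ> F \<circ> inv_into U \<phi>))"

text \<open>\<open>cmp \<G> b a\<close> is the composite of \<open>a\<close> followed by \<open>b\<close>; \<open>atlas\<close> is a smooth atlas of the
  space of objects.\<close>

record ('o, 'a) top_groupoid =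
  objs :: "'o topology"
  arrs :: "'a topology"
  src :: "'a \<Rightarrow> 'o"
  tgt :: "'a \<Rightarrow> 'o"
  unt :: "'o \<Rightarrow> 'a"
  cmp :: "'a \<Rightarrow> 'a \<Rightarrow> 'a"
  ivs :: "'a \<Rightarrow> 'a"
  atlas :: "('o set \<times> ('o \<Rightarrow> nat \<Rightarrow> real)) set"

locale topological_groupoid =
  fixes \<G> :: "('o, 'a) top_groupoid"
  assumes src_continuous: "continuous_map (arrs \<G>) (objs \<G>) (src \<G>)"
    and tgt_continuous: "continuous_map (arrs \<G>) (objs \<G>) (tgt \<G>)"
    and unt_continuous: "continuous_map (objs \<G>) (arrs \<G>) (unt \<G>)"
    and ivs_continuous: "continuous_map (arrs \<G>) (arrs \<G>) (ivs \<G>)"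
    and cmp_continuous:
      "continuous_map (subtopology (prod_topology (arrs \<G>) (arrs \<G>)) {(b, a). src \<G> b = tgt \<G> a})
         (arrs \<G>) (\<lambda>(b, a). cmp \<G> b a)"
    and src_cmp: "\<lbrakk>a \<in> topspace (arrs \<G>); b \<in> topspace (arrs \<G>); src \<G> b = tgt \<G> a\<rbrakk>
      \<Longrightarrow> src \<G> (cmp \<G> b a) = src \<G> a"
    and tgt_cmp: "\<lbrakk>a \<in> topspace (arrs \<G>); b \<in> topspace (arrs \<G>); src \<G> b = tgt \<G> a\<rbrakk>
      \<Longrightarrow> tgt \<G> (cmp \<G> b a) = tgt \<G> b"
    and cmp_assoc: "\<lbrakk>a \<in> topspace (arrs \<G>); b \<in> topspace (arrs \<G>); c \<in> topspace (arrs \<G>);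
        src \<G> b = tgt \<G> a; src \<G> c = tgt \<G> b\<rbrakk>
      \<Longrightarrow> cmp \<G> c (cmp \<G> b a) = cmp \<G> (cmp \<G> c b) a"
    and src_unt: "x \<in> topspace (objs \<G>) \<Longrightarrow> src \<G> (unt \<G> x) = x"
    and tgt_unt: "x \<in> topspace (objs \<G>) \<Longrightarrow> tgt \<G> (unt \<G> x) = x"
    and cmp_unt_right: "a \<in> topspace (arrs \<G>) \<Longrightarrow> cmp \<G> a (unt \<G> (src \<G> a)) = a"
    and cmp_unt_left: "a \<in> topspace (arrs \<G>) \<Longrightarrow> cmp \<G> (unt \<G> (tgt \<G> a)) a = a"
    and src_ivs: "a \<in> topspace (arrs \<G>) \<Longrightarrow> src \<G> (ivs \<G> a) = tgt \<G> a"
    and tgt_ivs: "a \<in> topspace (arrs \<G>) \<Longrightarrow> tgt \<G> (ivs \<G> a) = src \<G> a"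
    and cmp_ivs_left: "a \<in> topspace (arrs \<G>) \<Longrightarrow> cmp \<G> (ivs \<G> a) a = unt \<G> (src \<G> a)"
    and cmp_ivs_right: "a \<in> topspace (arrs \<G>) \<Longrightarrow> cmp \<G> a (ivs \<G> a) = unt \<G> (tgt \<G> a)"

text \<open>Since \<open>src\<close> is a local homeomorphism, the space of arrows carries the smooth structure
  pulled back along \<open>src\<close>, and smoothness of all structure maps amounts to smoothness of \<open>tgt\<close>
  read through the local inverses of \<open>src\<close>.\<close>

locale orbifold = topological_groupoid \<G> for \<G> :: "('o, 'a) top_groupoid" +
  fixes n :: nat
    and M :: "'m topology"
    and \<pi> :: "'o \<Rightarrow> 'm"
  assumes objs_Hausdorff: "Hausdorff_space (objs \<G>)"
    and arrs_Hausdorff: "Hausdorff_space (arrs \<G>)"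
    and objs_second_countable: "second_countable (objs \<G>)"
    and arrs_second_countable: "second_countable (arrs \<G>)"
    and atlas_chart: "(U, \<phi>) \<in> atlas \<G> \<Longrightarrow> openin (objs \<G>) U \<and> openin (Euclidean_space n) (\<phi> ` U) \<and>
        homeomorphic_map (subtopology (objs \<G>) U) (subtopology (Euclidean_space n) (\<phi> ` U)) \<phi>"
    and atlas_cover: "(\<Union>(U, \<phi>)\<in>atlas \<G>. U) = topspace (objs \<G>)"
    and atlas_smooth: "smooth_in_charts n (atlas \<G>) (topspace (objs \<G>)) id"
    and etale: "a \<in> topspace (arrs \<G>) \<Longrightarrow> \<exists>W. a \<in> W \<and> openin (arrs \<G>) W \<and>
        openin (objs \<G>) (src \<G> ` W) \<and>
        homeomorphic_map (subtopology (arrs \<G>) W) (subtopology (objs \<G>) (src \<G> ` W)) (src \<G>)"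
    and tgt_smooth: "\<lbrakk>openin (arrs \<G>) W; inj_on (src \<G>) W\<rbrakk>
      \<Longrightarrow> smooth_in_charts n (atlas \<G>) (src \<G> ` W) (tgt \<G> \<circ> inv_into W (src \<G>))"
    and proper: "proper_map (arrs \<G>) (prod_topology (objs \<G>) (objs \<G>)) (\<lambda>a. (src \<G> a, tgt \<G> a))"
    and orbit_quotient: "quotient_map (objs \<G>) M \<pi>"
    and orbits: "\<lbrakk>x \<in> topspace (objs \<G>); y \<in> topspace (objs \<G>)\<rbrakk>
      \<Longrightarrow> \<pi> x = \<pi> y \<longleftrightarrow> (\<exists>a\<in>topspace (arrs \<G>). src \<G> a = x \<and> tgt \<G> a = y)"

definition isotropy_group :: "('o, 'a) top_groupoid \<Rightarrow> 'o \<Rightarrow> 'a monoid" where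
  "isotropy_group \<G> x =
     \<lparr>carrier = {a \<in> topspace (arrs \<G>). src \<G> a = x \<and> tgt \<G> a = x}, mult = cmp \<G>, one = unt \<G> x\<rparr>"

text \<open>An orbifold chart is an open set \<open>cdom\<close> of objects with a finite group \<open>grp\<close> acting on it
  such that the restriction of \<open>\<G>\<close> to \<open>cdom\<close> is the action groupoid: \<open>germ c g x\<close> is the arrow
  from \<open>x\<close> to \<open>g \<cdot> x\<close> given by the group element \<open>g\<close>. The action is recovered as \<open>g \<cdot> x = tgt (germ c g x)\<close>, and the underlying space of the chart is \<open>\<pi> ` cdom \<cong> cdom / grp\<close>.\<close>

record ('o, 'a, 'g) orbi_chart =
  cdom :: "'o set"
  grp :: "'g monoid"
  germ :: "'g \<Rightarrow> 'o \<Rightarrow> 'a"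

definition chart_act :: "('o, 'a) top_groupoid \<Rightarrow> ('o, 'a, 'g) orbi_chart \<Rightarrow> 'g \<Rightarrow> 'o \<Rightarrow> 'o" where
  "chart_act \<G> c g x = tgt \<G> (germ c g x)"

locale orbifold_chart =
  fixes \<G> :: "('o, 'a) top_groupoid" and c :: "('o, 'a, 'g) orbi_chart"
  assumes dom_open: "openin (objs \<G>) (cdom c)"
    and grp_group: "group (grp c)"
    and grp_finite: "finite (carrier (grp c))"
    and germ_src: "\<lbrakk>g \<in> carrier (grp c); x \<in> cdom c\<rbrakk> \<Longrightarrow> src \<G> (germ c g x) = x"
    and germ_one: "x \<in> cdom c \<Longrightarrow> germ c \<one>\<^bsub>grp c\<^esub> x = unt \<G> x"
    and germ_mult: "\<lbrakk>g \<in> carrier (grp c); h \<in> carrier (grp c); x \<in> cdom c\<rbrakk>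
      \<Longrightarrow> germ c (g \<otimes>\<^bsub>grp c\<^esub> h) x = cmp \<G> (germ c g (chart_act \<G> c h x)) (germ c h x)"
    and germ_homeo: "homeomorphic_map
        (prod_topology (discrete_topology (carrier (grp c))) (subtopology (objs \<G>) (cdom c)))
        (subtopology (arrs \<G>) {a. src \<G> a \<in> cdom c \<and> tgt \<G> a \<in> cdom c})
        (\<lambda>(g, x). germ c g x)"


section \<open>Triangulated orbifolds and their complexes of groups\<close>

text \<open>A triangulation is taken together with the choice, for each simplex \<open>p\<close>, of a chart and of
  a continuous lift \<open>lift T p : p \<rightarrow> cdom\<close>, which enter the complex of groups.\<close>

record ('o, 'a, 'g, 'e, 'm) triang =
  cplx :: "'e set set"
  homeo :: "'e \<Rightarrow> 'm"
  chart :: "'e set \<Rightarrow> ('o, 'a, 'g) orbi_chart"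
  lift :: "'e set \<Rightarrow> 'e \<Rightarrow> 'o"

text \<open>A library simplicial complex contains the empty face, of dimension \<open>-1\<close>.\<close>

definition simplices :: "('o, 'a, 'g, 'e, 'm) triang \<Rightarrow> 'e set set" where
  "simplices T = cplx T - {{}}"

locale orbifold_triangulation =
  fixes \<G> :: "('o, 'a) top_groupoid" and M :: "'m topology" and \<pi> :: "'o \<Rightarrow> 'm"
    and T :: "('o, 'a, 'g, 'e::euclidean_space, 'm) triang"
  assumes complex: "simplicial_complex (cplx T)"
    and homeo: "homeomorphic_map (top_of_set (\<Union>(cplx T))) M (homeo T)"
    and chart: "p \<in> simplices T \<Longrightarrow> orbifold_chart \<G> (chart T p)"
    and lift_continuous: "p \<in> simplices T \<Longrightarrow>
        continuous_map (top_of_set p) (subtopology (objs \<G>) (cdom (chart T p))) (lift T p)"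
    and lift_over: "\<lbrakk>p \<in> simplices T; x \<in> p\<rbrakk> \<Longrightarrow> \<pi> (lift T p x) = homeo T x"
    and isotropy_constant: "\<lbrakk>p \<in> simplices T; x \<in> rel_interior p; y \<in> rel_interior p\<rbrakk>
      \<Longrightarrow> isotropy_group \<G> (lift T p x) \<cong> isotropy_group \<G> (lift T p y)"

definition stabilizer ::
  "('o, 'a) top_groupoid \<Rightarrow> ('o, 'a, 'g, 'e, 'm) triang \<Rightarrow> 'e set \<Rightarrow> 'g monoid" where
  "stabilizer \<G> T p = (grp (chart T p))\<lparr>carrier :=
     {g \<in> carrier (grp (chart T p)). \<forall>x\<in>p. chart_act \<G> (chart T p) g (lift T p x) = lift T p x}\<rparr>"

definition orbifold_euler_char ::
  "('o, 'a) top_groupoid \<Rightarrow> ('o, 'a, 'g, 'e::euclidean_space, 'm) triang \<Rightarrow> rat" where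
  "orbifold_euler_char \<G> T =
     (\<Sum>p\<in>simplices T. (-1) ^ nat (aff_dim p) / of_nat (card (carrier (stabilizer \<G> T p))))"

text \<open>For a face \<open>q\<close> of \<open>p\<close>, the chosen arrow from the face of the lift of \<open>p\<close> over \<open>q\<close> to the
  lift of \<open>q\<close> is a family of arrows of \<open>\<G>\<close> depending continuously on the point \<open>x\<close> of \<open>q\<close>. As
  the isotropy is constant along the interior of \<open>q\<close>, any single arrow over an interior point
  extends uniquely to such a family.\<close>

definition chosen_arrows ::
  "('o, 'a) top_groupoid \<Rightarrow> ('o, 'a, 'g, 'e::euclidean_space, 'm) triang
     \<Rightarrow> ('e set \<Rightarrow> 'e set \<Rightarrow> 'e \<Rightarrow> 'a) \<Rightarrow> bool" where
  "chosen_arrows \<G> T \<alpha> \<longleftrightarrow> (\<forall>p\<in>simplices T. \<forall>q\<in>simplices T. q \<subseteq> p \<longrightarrow>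
     continuous_map (top_of_set q) (arrs \<G>) (\<alpha> p q) \<and>
     (\<forall>x\<in>q. src \<G> (\<alpha> p q x) = lift T p x \<and> tgt \<G> (\<alpha> p q x) = lift T q x))"

text \<open>The homomorphism \<open>G p \<rightarrow> G q\<close> is \<open>g \<mapsto> \<alpha>\<^sub>p\<^sub>q g \<alpha>\<^sub>p\<^sub>q\<inverse>\<close>; the coherence elements are \<open>\<alpha>\<^sub>q\<^sub>r
  \<alpha>\<^sub>p\<^sub>q \<alpha>\<^sub>p\<^sub>r\<inverse> \<in> G r\<close> and \<open>\<alpha>\<^sub>p\<^sub>p\<inverse> \<in> G p\<close>.\<close>

definition face_hom ::
  "('o, 'a) top_groupoid \<Rightarrow> ('o, 'a, 'g, 'e, 'm) triang \<Rightarrow> ('e set \<Rightarrow> 'e set \<Rightarrow> 'e \<Rightarrow> 'a)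
     \<Rightarrow> 'e set \<Rightarrow> 'e set \<Rightarrow> 'g \<Rightarrow> 'g" where
  "face_hom \<G> T \<alpha> p q g = (THE h. h \<in> carrier (stabilizer \<G> T q) \<and>
     (\<forall>x\<in>q. cmp \<G> (germ (chart T q) h (lift T q x)) (\<alpha> p q x)
          = cmp \<G> (\<alpha> p q x) (germ (chart T p) g (lift T p x))))"

definition face_coh_comp ::
  "('o, 'a) top_groupoid \<Rightarrow> ('o, 'a, 'g, 'e, 'm) triang \<Rightarrow> ('e set \<Rightarrow> 'e set \<Rightarrow> 'e \<Rightarrow> 'a)
     \<Rightarrow> 'e set \<Rightarrow> 'e set \<Rightarrow> 'e set \<Rightarrow> 'g" where
  "face_coh_comp \<G> T \<alpha> p q r = (THE h. h \<in> carrier (stabilizer \<G> T r) \<and>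
     (\<forall>x\<in>r. cmp \<G> (germ (chart T r) h (lift T r x)) (\<alpha> p r x) = cmp \<G> (\<alpha> q r x) (\<alpha> p q x)))"

definition face_coh_id ::
  "('o, 'a) top_groupoid \<Rightarrow> ('o, 'a, 'g, 'e, 'm) triang \<Rightarrow> ('e set \<Rightarrow> 'e set \<Rightarrow> 'e \<Rightarrow> 'a)
     \<Rightarrow> 'e set \<Rightarrow> 'g" where
  "face_coh_id \<G> T \<alpha> p = (THE h. h \<in> carrier (stabilizer \<G> T p) \<and>
     (\<forall>x\<in>p. cmp \<G> (germ (chart T p) h (lift T p x)) (\<alpha> p p x) = unt \<G> (lift T p x)))"

definition stabilizer_complex ::
  "('o, 'a) top_groupoid \<Rightarrow> ('o, 'a, 'g, 'e, 'm) triang \<Rightarrow> ('e set \<Rightarrow> 'e set \<Rightarrow> 'e \<Rightarrow> 'a)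
     \<Rightarrow> ('e set, unit, unit, 'g) cat_valued" where
  "stabilizer_complex \<G> T \<alpha> = \<lparr>
     val = (\<lambda>p. group_cat (stabilizer \<G> T p)),
     act_ob = (\<lambda>_ _ _ _. ()),
     act_mor = (\<lambda>p q _ _ _. face_hom \<G> T \<alpha> p q),
     coh_comp = (\<lambda>p q r _ _ _. face_coh_comp \<G> T \<alpha> p q r),
     coh_id = (\<lambda>p _. face_coh_id \<G> T \<alpha> p)\<rparr>"


section \<open>The stabilizers form a complex of groups\<close>

text \<open>The elements described by \<^const>\<open>face_hom\<close>, \<^const>\<open>face_coh_comp\<close> and \<^const>\<open>face_coh_id\<close> exist because a
  continuous family of isotropy arrows along the lift of a simplex is given by a single element
  of the chart group, the simplex being connected.\<close>

context topological_groupoid begin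

definition hom_arrs where
  "hom_arrs x y = {a\<in>topspace (arrs \<G>). src \<G> a = x \<and> tgt \<G> a = y}"

lemma ar_cmp:
  assumes "a \<in> hom_arrs x y" "b \<in> hom_arrs y z"
  shows "cmp \<G> b a \<in> hom_arrs x z"
proof -
  have "(\<lambda>(b, a). cmp \<G> b a) (b,a) \<in> topspace (arrs \<G>)"
    by (rule funcset_mem[OF continuous_map_funspace[OF cmp_continuous]]) (use assms in \<open>simp
        add: hom_arrs_def\<close>)
  then show ?thesis using assms src_cmp tgt_cmp by (simp add: hom_arrs_def)
qed

lemma ar_assoc:
  assumes "a \<in> hom_arrs x y" "b \<in> hom_arrs y z" "c \<in> hom_arrs z w"
  shows "cmp \<G> c (cmp \<G> b a) = cmp \<G> (cmp \<G> c b) a"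
  by (rule cmp_assoc) (use assms in \<open>simp_all add: hom_arrs_def\<close>)

lemma tops: "a \<in> topspace (arrs \<G>) \<Longrightarrow> src \<G> a \<in> topspace (objs \<G>)" "a \<in> topspace (arrs \<G>) \<Longrightarrow> tgt \<G>
    a \<in> topspace (objs \<G>)"
  "a \<in> topspace (arrs \<G>) \<Longrightarrow> ivs \<G> a \<in> topspace (arrs \<G>)"
  "x \<in> topspace (objs \<G>) \<Longrightarrow> unt \<G> x \<in> topspace (arrs \<G>)"
  by (rule funcset_mem[OF continuous_map_funspace], rule src_continuous tgt_continuous
      ivs_continuous unt_continuous, assumption)+

lemma ar_ivs: "a \<in> hom_arrs x y \<Longrightarrow> ivs \<G> a \<in> hom_arrs y x"
  unfolding hom_arrs_def using tops src_ivs tgt_ivs by blast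

lemma ar_unt: "x \<in> topspace (objs \<G>) \<Longrightarrow> unt \<G> x \<in> hom_arrs x x" unfolding hom_arrs_def using tops
    src_unt tgt_unt by blast

lemma ar_unt_right: "a \<in> hom_arrs x y \<Longrightarrow> cmp \<G> a (unt \<G> x) = a"
  unfolding hom_arrs_def using cmp_unt_right by blast

lemma ar_unt_left: "a \<in> hom_arrs x y \<Longrightarrow> cmp \<G> (unt \<G> y) a = a"
  unfolding hom_arrs_def using cmp_unt_left by blast

lemma ar_ivs_left: "a \<in> hom_arrs x y \<Longrightarrow> cmp \<G> (ivs \<G> a) a = unt \<G> x"
  unfolding hom_arrs_def using cmp_ivs_left by blast

lemma ar_ivs_right: "a \<in> hom_arrs x y \<Longrightarrow> cmp \<G> a (ivs \<G> a) = unt \<G> y" unfolding hom_arrs_def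
    using cmp_ivs_right by blast

lemma ar_cancel_right:
  assumes "a \<in> hom_arrs x y" "b \<in> hom_arrs y z" "c \<in> hom_arrs y z" "cmp \<G> b a = cmp \<G> c a"
  shows "b = c"
proof -
  have "d = cmp \<G> (cmp \<G> d a) (ivs \<G> a)" if "d \<in> hom_arrs y z" for d
    unfolding ar_assoc[OF ar_ivs[OF assms(1)] assms(1) that, symmetric] ar_ivs_right[OF
        assms(1)] ar_unt_right[OF that] ..
  from this[OF assms(2)] this[OF assms(3)] assms(4) show ?thesis by argo
qed

lemma ar_cancel_left:
  assumes "a \<in> hom_arrs y z" "b \<in> hom_arrs x y" "c \<in> hom_arrs x y" "cmp \<G> a b = cmp \<G> a c"
  shows "b = c"
proof -
  have "d = cmp \<G> (ivs \<G> a) (cmp \<G> a d)" if "d \<in> hom_arrs x y" for d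
    unfolding ar_assoc[OF that assms(1) ar_ivs[OF assms(1)]] ar_ivs_left[OF assms(1)]
        ar_unt_left[OF that] ..
  from this[OF assms(2)] this[OF assms(3)] assms(4) show ?thesis by argo
qed

lemma ar_obj: "a \<in> hom_arrs x y \<Longrightarrow> x \<in> topspace (objs \<G>)" "a \<in> hom_arrs x y \<Longrightarrow> y \<in> topspace (objs \<G>)"
  unfolding hom_arrs_def using tops by blast+

lemma cmp_cont: assumes "continuous_map Z (arrs \<G>) f" "continuous_map Z (arrs \<G>) g"
   "\<And>x. x \<in> topspace Z \<Longrightarrow> src \<G> (g x) = tgt \<G> (f x)"
 shows "continuous_map Z (arrs \<G>) (\<lambda>x. cmp \<G> (g x) (f x))"
proof -
  have 1: "continuous_map Z (prod_topology (arrs \<G>) (arrs \<G>)) (\<lambda>x. (g x, f x))"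
    using assms(1,2) by (rule continuous_map_pairedI[rotated])
  have "continuous_map Z (subtopology (prod_topology (arrs \<G>) (arrs \<G>)) {(b, a). src \<G> b = tgt \<G>
      a}) (\<lambda>x. (g x, f x))"
    unfolding continuous_map_in_subtopology using 1 assms(3) by auto
  from continuous_map_compose[OF this cmp_continuous]
  show ?thesis unfolding o_def split .
qed
end

locale triangulated_groupoid = topological_groupoid \<G> + orbifold_triangulation \<G> M \<pi> T
  for \<G> :: "('o, 'a) top_groupoid" and M :: "'m topology" and \<pi> :: "'o \<Rightarrow> 'm"
    and T :: "('o, 'a, 'g, 'e::euclidean_space, 'm) triang" +
  fixes \<alpha>
  assumes chosen: "chosen_arrows \<G> T \<alpha>"
begin
abbreviation "P \<equiv> simplices T"
abbreviation "S \<equiv> stabilizer \<G> T"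

definition gm where
  "gm p g x = germ (chart T p) g (lift T p x)"

lemma simplexD: assumes "p \<in> P" shows "p \<noteq> {}" "connected p"
proof -
  show "p \<noteq> {}" using assms by (simp add: simplices_def)
  obtain n where "n simplex p" using assms complex unfolding simplices_def
      simplicial_complex_def by blast
  then have "convex p" by (auto simp: simplex_def)
  then show "connected p" by (rule convex_connected)
qed

lemma lift_in: assumes "p \<in> P" "x \<in> p" shows "lift T p x \<in> cdom (chart T p)"
  using lift_continuous[OF assms(1)] assms(2) by (auto simp: continuous_map_def Pi_iff)

lemma dom_obj: "p \<in> P \<Longrightarrow> cdom (chart T p) \<subseteq> topspace (objs \<G>)"
  using orbifold_chart.dom_open[OF chart] openin_subset by blast

lemma germ_top: assumes "p \<in> P" "g \<in> carrier (grp (chart T p))" "x \<in> cdom (chart T p)" shows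
    "germ (chart T p) g x \<in> topspace (arrs \<G>)"
  using homeomorphic_imp_continuous_map[OF orbifold_chart.germ_homeo[OF chart[OF assms(1)]]]
      assms dom_obj[OF assms(1)]
  by (auto simp: continuous_map_def Pi_iff)

lemma S_carr: "carrier (S p) = {g \<in> carrier (grp (chart T p)). \<forall>x\<in>p. chart_act \<G> (chart T p) g
    (lift T p x) = lift T p x}"
   and S_mult: "mult (S p) = mult (grp (chart T p))" and S_one: "one (S p) = one (grp (chart T p))"
  by (simp_all add: stabilizer_def)

lemma gm_ar: "p \<in> P \<Longrightarrow> g \<in> carrier (S p) \<Longrightarrow> x \<in> p \<Longrightarrow> gm p g x \<in> hom_arrs (lift T p x) (lift T p x)"
  unfolding hom_arrs_def gm_def S_carr using germ_top lift_in orbifold_chart.germ_src[OF chart]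
  by (auto simp: chart_act_def)

lemma gm_mult: "p \<in> P \<Longrightarrow> g \<in> carrier (S p) \<Longrightarrow> h \<in> carrier (S p) \<Longrightarrow> x \<in> p \<Longrightarrow>
   gm p (g \<otimes>\<^bsub>S p\<^esub> h) x = cmp \<G> (gm p g x) (gm p h x)"
  unfolding gm_def S_mult using orbifold_chart.germ_mult[OF chart, of p g h "lift T p x"] lift_in
  by (auto simp: S_carr)

lemma gm_one: "p \<in> P \<Longrightarrow> x \<in> p \<Longrightarrow> gm p \<one>\<^bsub>S p\<^esub> x = unt \<G> (lift T p x)"
  unfolding gm_def S_one using orbifold_chart.germ_one[OF chart, of p "lift T p x"] lift_in by auto

lemma gm_inj:
  assumes "p \<in> P" "g \<in> carrier (S p)" "h \<in> carrier (S p)" "x \<in> p" "gm p g x = gm p h x"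
  shows "g = h"
proof -
  have l: "lift T p x \<in> topspace (objs \<G>)" "lift T p x \<in> cdom (chart T p)" using lift_in dom_obj
      assms by blast+
  have "(g, lift T p x) = (h, lift T p x)"
    by (rule inj_onD[OF homeomorphic_imp_injective_map[OF orbifold_chart.germ_homeo[OF chart[OF
        assms(1)]]]])
       (use assms l in \<open>simp_all add: gm_def S_carr\<close>)
  then show ?thesis by simp
qed

lemma S_group: assumes p: "p \<in> P" shows "group (S p)"
proof -
  interpret c: orbifold_chart \<G> "chart T p" using chart[OF p] .
  interpret g: group "grp (chart T p)" using c.grp_group .
  have act: "chart_act \<G> (chart T p) (a \<otimes>\<^bsub>grp (chart T p)\<^esub> b) x =
    chart_act \<G> (chart T p) a (chart_act \<G> (chart T p) b x)"
    if "a \<in> carrier (grp (chart T p))" "b \<in> carrier (grp (chart T p))" "x \<in> cdom (chart T p)"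
        for a b x
  proof -
    have 1: "chart_act \<G> (chart T p) b x \<in> cdom (chart T p)"
      using homeomorphic_imp_continuous_map[OF c.germ_homeo] that dom_obj[OF p]
      by (auto simp: continuous_map_def Pi_iff chart_act_def)
    show ?thesis using that c.germ_mult[of a b x] tgt_cmp[of "germ (chart T p) b x" "germ (chart
        T p) a (chart_act \<G> (chart T p) b x)"]
       germ_top[OF p] 1 c.germ_src by (simp add: chart_act_def)
  qed
  have act1: "chart_act \<G> (chart T p) \<one>\<^bsub>grp (chart T p)\<^esub> x = x" if "x \<in> cdom (chart T p)" for x
    using c.germ_one that tgt_unt dom_obj[OF p] by (auto simp: chart_act_def)
  have "subgroup (carrier (S p)) (grp (chart T p))"
  proof (rule g.subgroupI)
    show "carrier (S p) \<noteq> {}" using act1 lift_in[OF p] by (auto simp: S_carr)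
    fix a assume a: "a \<in> carrier (S p)"
    then have ac: "a \<in> carrier (grp (chart T p))" by (simp add: S_carr)
    have "chart_act \<G> (chart T p) (inv\<^bsub>grp (chart T p)\<^esub> a) (lift T p x) = lift T p x" if "x \<in> p"
        for x
      using act[of "inv\<^bsub>grp (chart T p)\<^esub> a" a "lift T p x"] a that lift_in[OF p that] act1 by
          (simp add: S_carr)
    then show "inv\<^bsub>grp (chart T p)\<^esub> a \<in> carrier (S p)" using ac by (simp add: S_carr)
  qed (use act lift_in[OF p] in \<open>auto simp: S_carr\<close>)
  from g.subgroup_imp_group[OF this]
  show ?thesis by (simp add: stabilizer_def)
qed

lemma S_finite: "p \<in> P \<Longrightarrow> finite (carrier (S p))"
  using orbifold_chart.grp_finite[OF chart] by (auto simp: S_carr)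

lemma gm_cont:
  assumes "p \<in> P" "g \<in> carrier (S p)"
  shows "continuous_map (top_of_set p) (arrs \<G>) (gm p g)"
proof -
  have "continuous_map (top_of_set p) (prod_topology (discrete_topology (carrier (grp (chart T
    p)))) (subtopology (objs \<G>) (cdom (chart T p)))) (\<lambda>x. (g, lift T p x))"
    using assms lift_continuous[OF assms(1)] by (auto simp: continuous_map_pairwise o_def S_carr)
  from continuous_map_compose[OF this homeomorphic_imp_continuous_map[OF
      orbifold_chart.germ_homeo[OF chart[OF assms(1)]]]]
  show ?thesis by (simp add: continuous_map_in_subtopology o_def gm_def[abs_def])
qed

lemma key:
  assumes p: "p \<in> P" and b: "continuous_map (top_of_set p) (arrs \<G>) b" "\<And>x. x \<in> p \<Longrightarrow> b x \<in>
      hom_arrs (lift T p x) (lift T p x)"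
  shows "\<exists>h\<in>carrier (S p). \<forall>x\<in>p. gm p h x = b x"
proof -
  interpret c: orbifold_chart \<G> "chart T p" using chart[OF p] .
  let ?G = "carrier (grp (chart T p))" let ?U = "subtopology (objs \<G>) (cdom (chart T p))"
  let ?V = "subtopology (arrs \<G>) {a. src \<G> a \<in> cdom (chart T p) \<and> tgt \<G> a \<in> cdom (chart T p)}"
  let ?f = "\<lambda>(g, x). germ (chart T p) g x"
  obtain k where k: "homeomorphic_maps (prod_topology (discrete_topology ?G) ?U) ?V ?f k"
    using c.germ_homeo homeomorphic_map_maps by blast
  have b': "continuous_map (top_of_set p) ?V b"
    using b lift_in[OF p] by (auto simp: continuous_map_in_subtopology hom_arrs_def)
  have kc: "continuous_map (top_of_set p) (prod_topology (discrete_topology ?G) ?U) (k \<circ> b)"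
      using b' k by (auto simp: homeomorphic_maps_def intro: continuous_map_compose)
  have fc: "continuous_map (top_of_set p) (discrete_topology ?G) (fst \<circ> (k \<circ> b))"
    using kc continuous_map_compose continuous_map_fst by blast
  have fk: "?f (k (b x)) = b x" if "x \<in> p" for x
    using k b' that by (auto simp: homeomorphic_maps_def continuous_map_def Pi_iff)
  have kin: "fst (k (b x)) \<in> ?G" "snd (k (b x)) \<in> cdom (chart T p)" if "x \<in> p" for x using kc
      that by (auto simp: continuous_map_def Pi_iff)
  have sk: "snd (k (b x)) = lift T p x" if "x \<in> p" for x
    using c.germ_src[OF kin[OF that]] fk[OF that] b(2)[OF that] by (auto simp: hom_arrs_def
        split_beta)
  obtain x0 where x0: "x0 \<in> p" using simplexD[OF p] by blast
  have "connectedin (discrete_topology ?G) ((fst \<circ> (k \<circ> b)) ` p)"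
    using connectedin_continuous_map_image[OF fc] simplexD(2)[OF p] by (simp add:
        connectedin_subtopology)
  then obtain h where h: "(fst \<circ> (k \<circ> b)) ` p \<subseteq> {h}"
    using x0 by (auto simp: connectedin_discrete_topology)
  then have hx: "fst (k (b x)) = h" if "x \<in> p" for x using that by auto
  have g: "gm p h x = b x" if "x \<in> p" for x
    using fk[OF that] hx[OF that] sk[OF that] by (simp add: gm_def split_beta)
  have "h \<in> carrier (S p)"
    using hx[OF x0] kin[OF x0] g b(2) by (auto simp: S_carr chart_act_def gm_def hom_arrs_def)
  then show ?thesis using g by blast
qed

lemma al:
  assumes "p \<in> P" "q \<in> P" "q \<subseteq> p"
  shows "continuous_map (top_of_set q) (arrs \<G>) (\<alpha> p q)"
   "\<And>x. x \<in> q \<Longrightarrow> \<alpha> p q x \<in> hom_arrs (lift T p x) (lift T q x)"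
proof -
  show c: "continuous_map (top_of_set q) (arrs \<G>) (\<alpha> p q)"
    using chosen assms unfolding chosen_arrows_def by blast
  fix x assume x: "x \<in> q"
  have "\<alpha> p q x \<in> topspace (arrs \<G>)" by (rule funcset_mem[OF continuous_map_funspace[OF c]])
      (use x in simp)
  then show "\<alpha> p q x \<in> hom_arrs (lift T p x) (lift T q x)"
    using chosen assms x unfolding chosen_arrows_def hom_arrs_def by blast
qed

lemma key2: assumes p: "p \<in> P" and q: "q \<in> P" and qp: "q \<subseteq> p"
   and b: "continuous_map (top_of_set q) (arrs \<G>) b" "\<And>x. x \<in> q \<Longrightarrow> b x \<in> hom_arrs (lift T p x)
       (lift T q x)"
  defines "t \<equiv> THE h. h \<in> carrier (S q) \<and> (\<forall>x\<in>q. cmp \<G> (germ (chart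
    T q) h (lift T q x)) (\<alpha> p q x) = b x)"
  shows "t \<in> carrier (S q)" "\<And>x. x \<in> q \<Longrightarrow> cmp \<G> (gm q t x) (\<alpha> p q x) = b x"
proof -
  let ?b = "\<lambda>x. cmp \<G> (b x) (ivs \<G> (\<alpha> p q x))"
  have "continuous_map (top_of_set q) (arrs \<G>) (\<lambda>x. ivs \<G> (\<alpha> p q x))"
    using continuous_map_compose[OF al(1)[OF p q qp] ivs_continuous] by (simp add: o_def)
  then have bc: "continuous_map (top_of_set q) (arrs \<G>) ?b"
  proof (rule cmp_cont[OF _ b(1)])
    fix x assume "x \<in> topspace (top_of_set q)" then have x: "x \<in> q" by simp
    show "src \<G> (b x) = tgt \<G> (ivs \<G> (\<alpha> p q x))"
      using ar_ivs[OF al(2)[OF p q qp x]] b(2)[OF x] by (simp add: hom_arrs_def)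
  qed
  have bin: "?b x \<in> hom_arrs (lift T q x) (lift T q x)" if "x \<in> q" for x
    by (rule ar_cmp[OF ar_ivs[OF al(2)[OF p q qp that]] b(2)[OF that]])
  obtain h where h: "h \<in> carrier (S q)" "\<And>x. x \<in> q \<Longrightarrow> gm q h x = ?b x" using key[OF q bc bin] by
      blast
  have ex: "cmp \<G> (gm q h x) (\<alpha> p q x) = b x" if "x \<in> q" for x
    unfolding h(2)[OF that] ar_assoc[OF al(2)[OF p q qp that] ar_ivs[OF al(2)[OF p q qp that]]
        b(2)[OF that], symmetric]
      ar_ivs_left[OF al(2)[OF p q qp that]] ar_unt_right[OF b(2)[OF that]] ..
  obtain x0 where x0: "x0 \<in> q" using simplexD[OF q] by blast
  have "\<exists>!h. h \<in> carrier (S q) \<and> (\<forall>x\<in>q. cmp \<G> (gm q h x) (\<alpha>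
    p q x) = b x)"
  proof (intro ex1I conjI ballI)
    fix h' assume "h' \<in> carrier (S q) \<and> (\<forall>x\<in>q. cmp \<G> (gm q h' x) (\<alpha>
      p q x) = b x)"
    then have h': "h' \<in> carrier (S q)" "cmp \<G> (gm q h' x0) (\<alpha> p q x0) = b x0" using x0 by blast+
    show "h' = h" by (rule gm_inj[OF q h'(1) h(1) x0])
      (rule ar_cancel_right[OF al(2)[OF p q qp x0] gm_ar[OF q h'(1) x0] gm_ar[OF q h(1) x0]],
          simp add: h'(2) ex[OF x0])
  qed (use h ex in blast)+
  from theI'[OF this] show "t \<in> carrier (S q)" "\<And>x. x \<in> q \<Longrightarrow> cmp \<G> (gm q t x) (\<alpha> p q x) = b x"
    unfolding t_def gm_def by blast+
qed

lemma fh: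
  assumes p: "p \<in> P" and q: "q \<in> P" and qp: "q \<subseteq> p" and g: "g \<in> carrier (S p)"
  shows "face_hom \<G> T \<alpha> p q g \<in> carrier (S q)"
    "\<And>x. x \<in> q \<Longrightarrow> cmp \<G> (gm q (face_hom \<G> T \<alpha> p q g) x) (\<alpha> p q x) = cmp \<G> (\<alpha> p q x) (gm p g x)"
proof -
  have 1: "\<And>x. x \<in> q \<Longrightarrow> cmp \<G> (\<alpha> p q x) (gm p g x) \<in> hom_arrs (lift T p x) (lift T q x)"
    using ar_cmp[OF gm_ar[OF p g] al(2)[OF p q qp]] qp by blast
  have 2: "continuous_map (top_of_set q) (arrs \<G>) (\<lambda>x. cmp \<G> (\<alpha> p q x) (gm p g x))"
    apply (rule cmp_cont[OF continuous_map_from_subtopology_mono[OF gm_cont[OF p g] qp] al(1)[OF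
        p q qp]])
    using gm_ar[OF p g] al(2)[OF p q qp] qp unfolding hom_arrs_def by force
  note k = key2[OF p q qp 2 1]
  show "face_hom \<G> T \<alpha> p q g \<in> carrier (S q)" unfolding face_hom_def using k(1) by (simp add:
      gm_def)
  show "\<And>x. x \<in> q \<Longrightarrow> cmp \<G> (gm q (face_hom \<G> T \<alpha> p q g) x) (\<alpha> p q x) = cmp \<G> (\<alpha> p q x) (gm p g x)"
    unfolding face_hom_def using k(2) by (simp add: gm_def)
qed

lemma fc:
  assumes p: "p \<in> P" and q: "q \<in> P" and r: "r \<in> P" and qp: "q \<subseteq> p" and rq: "r \<subseteq> q"
  shows "face_coh_comp \<G> T \<alpha> p q r \<in> carrier (S r)"
    "\<And>x. x \<in> r \<Longrightarrow> cmp \<G> (gm r (face_coh_comp \<G> T \<alpha> p q r) x) (\<alpha> p r x) = cmp \<G> (\<alpha> q r x) (\<alpha> p q x)"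
proof -
  have rp: "r \<subseteq> p" using qp rq by simp
  have 1: "\<And>x. x \<in> r \<Longrightarrow> cmp \<G> (\<alpha> q r x) (\<alpha> p q x) \<in> hom_arrs (lift T p x) (lift T r x)"
    using ar_cmp[OF al(2)[OF p q qp] al(2)[OF q r rq]] rq by blast
  have 2: "continuous_map (top_of_set r) (arrs \<G>) (\<lambda>x. cmp \<G> (\<alpha> q r x) (\<alpha> p q x))"
    apply (rule cmp_cont[OF continuous_map_from_subtopology_mono[OF al(1)[OF p q qp] rq]
        al(1)[OF q r rq]])
    using al(2)[OF q r rq] al(2)[OF p q qp] rq unfolding hom_arrs_def by force
  note k = key2[OF p r rp 2 1]
  show "face_coh_comp \<G> T \<alpha> p q r \<in> carrier (S r)" unfolding face_coh_comp_def using k(1) by simp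
  show "\<And>x. x \<in> r \<Longrightarrow> cmp \<G> (gm r (face_coh_comp \<G> T \<alpha> p q r)
    x) (\<alpha> p r x) = cmp \<G> (\<alpha> q r x) (\<alpha> p q x)"
    unfolding face_coh_comp_def using k(2) by simp
qed

lemma lift_cont: "p \<in> P \<Longrightarrow> continuous_map (top_of_set p) (objs \<G>) (lift T p)" using
    lift_continuous by (auto simp: continuous_map_in_subtopology)

lemma lift_obj: "p \<in> P \<Longrightarrow> x \<in> p \<Longrightarrow> lift T p x \<in> topspace (objs \<G>)"
  using lift_in dom_obj by blast

lemma fi: assumes p: "p \<in> P"
  shows "face_coh_id \<G> T \<alpha> p \<in> carrier (S p)"
    "\<And>x. x \<in> p \<Longrightarrow> cmp \<G> (gm p (face_coh_id \<G> T \<alpha> p) x) (\<alpha> p p x) = unt \<G> (lift T p x)"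
proof -
  have 1: "\<And>x. x \<in> p \<Longrightarrow> unt \<G> (lift T p x) \<in> hom_arrs (lift T p x) (lift T p x)"
    using ar_unt lift_obj[OF p] by blast
  have 2: "continuous_map (top_of_set p) (arrs \<G>) (\<lambda>x. unt \<G> (lift T p x))"
    using continuous_map_compose[OF lift_cont[OF p] unt_continuous] by (simp add: o_def)
  note k = key2[OF p p subset_refl 2 1]
  show "face_coh_id \<G> T \<alpha> p \<in> carrier (S p)" unfolding face_coh_id_def using k(1) by simp
  show "\<And>x. x \<in> p \<Longrightarrow> cmp \<G> (gm p (face_coh_id \<G> T \<alpha> p) x) (\<alpha> p p x) = unt \<G> (lift T p x)"
    unfolding face_coh_id_def using k(2) by simp
qed

lemma S_eqI:
  assumes "p \<in> P" "q \<in> P" "q \<subseteq> p" "g \<in> carrier (S q)" "h \<in> carrier (S q)"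
   "\<And>x. x \<in> q \<Longrightarrow> x \<in> p \<Longrightarrow> cmp \<G> (gm q g x) (\<alpha>
     p q x) = cmp \<G> (gm q h x) (\<alpha> p q x)"
 shows "g = h"
proof -
  obtain x where x: "x \<in> q" using simplexD[OF assms(2)] by blast
  have xp: "x \<in> p" using x assms(3) by blast
  show ?thesis by (rule gm_inj[OF assms(2,4,5) x ar_cancel_right[OF al(2)[OF assms(1-3) x]
      gm_ar[OF assms(2,4) x] gm_ar[OF assms(2,5) x] assms(6)[OF x xp]]])
qed

lemma S_mult_in: "p \<in> P \<Longrightarrow> g \<in> carrier (S p) \<Longrightarrow> h \<in> carrier (S p) \<Longrightarrow> g \<otimes>\<^bsub>S p\<^esub> h \<in> carrier (S p)"
  using S_group by (simp add: group.is_monoid monoid.m_closed)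

lemma S_one_in: "p \<in> P \<Longrightarrow> \<one>\<^bsub>S p\<^esub> \<in> carrier (S p)"
  using S_group by (simp add: group.is_monoid monoid.one_closed)

lemma fh_mult:
  assumes p: "p \<in> P" and q: "q \<in> P" and qp: "q \<subseteq> p" and g: "g \<in> carrier (S
    p)" "h \<in> carrier (S p)"
  shows "face_hom \<G> T \<alpha> p q (g \<otimes>\<^bsub>S p\<^esub> h) = face_hom \<G> T \<alpha> p q g \<otimes>\<^bsub>S q\<^esub> face_hom \<G> T \<alpha> p q h"
proof (rule S_eqI[OF p q qp])
  fix x assume x: "x \<in> q" "x \<in> p"
  note t = gm_ar[OF p g(1) x(2)] gm_ar[OF p g(2) x(2)] al(2)[OF p q qp x(1)]
     gm_ar[OF q fh(1)[OF p q qp g(1)] x(1)] gm_ar[OF q fh(1)[OF p q qp g(2)] x(1)]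
  show "cmp \<G> (gm q (face_hom \<G> T \<alpha> p q (g \<otimes>\<^bsub>S p\<^esub> h)) x) (\<alpha> p q x) =
     cmp \<G> (gm q (face_hom \<G> T \<alpha> p q g \<otimes>\<^bsub>S q\<^esub> face_hom \<G> T \<alpha> p q h) x) (\<alpha> p q x)"
    using fh(2)[OF p q qp g(1) x(1)] fh(2)[OF p q qp g(2) x(1)] fh(2)[OF p q qp S_mult_in[OF p
        g] x(1)]
      gm_mult[OF p g x(2)] gm_mult[OF q fh(1)[OF p q qp g(1)] fh(1)[OF p q qp g(2)] x(1)]
      ar_assoc[OF t(2) t(1) t(3)] ar_assoc[OF t(2) t(3) t(4)] ar_assoc[OF t(3) t(5) t(4)] by argo
qed (use assms fh S_mult_in in auto)

lemma fh_one: assumes p: "p \<in> P" and q: "q \<in> P" and qp: "q \<subseteq> p"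
  shows "face_hom \<G> T \<alpha> p q \<one>\<^bsub>S p\<^esub> = \<one>\<^bsub>S q\<^esub>"
proof (rule S_eqI[OF p q qp])
  fix x assume x: "x \<in> q" "x \<in> p"
  show "cmp \<G> (gm q (face_hom \<G> T \<alpha> p q \<one>\<^bsub>S p\<^esub>) x) (\<alpha> p q x) =
     cmp \<G> (gm q \<one>\<^bsub>S q\<^esub> x) (\<alpha> p q x)"
    using fh(2)[OF p q qp S_one_in[OF p] x(1)] gm_one[OF p x(2)] gm_one[OF q x(1)]
     ar_unt_left[OF al(2)[OF p q qp x(1)]] ar_unt_right[OF al(2)[OF p q qp x(1)]] by argo
qed (use assms fh S_one_in in auto)

lemma fh_inj: assumes p: "p \<in> P" and q: "q \<in> P" and qp: "q \<subseteq> p"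
  shows "inj_on (face_hom \<G> T \<alpha> p q) (carrier (S p))"
proof (rule inj_onI)
  fix g h assume g: "g \<in> carrier (S p)" "h \<in> carrier (S p)" and e: "face_hom \<G> T
    \<alpha> p q g = face_hom \<G> T \<alpha> p q h"
  obtain x where x: "x \<in> q" using simplexD[OF q] by blast
  with qp have xp: "x \<in> p" by blast
  show "g = h"
    using gm_inj[OF p g xp] ar_cancel_left[OF al(2)[OF p q qp x] gm_ar[OF p g(1) xp] gm_ar[OF p
        g(2) xp]]
      fh(2)[OF p q qp g(1) x] fh(2)[OF p q qp g(2) x] e by argo
qed

lemma fc_nat:
  assumes p: "p \<in> P" and q: "q \<in> P" and r: "r \<in> P" and qp: "q \<subseteq> p" and rq: "r \<subseteq> q" and g: "g \<in>
      carrier (S p)"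
  shows "face_coh_comp \<G> T \<alpha> p q r \<otimes>\<^bsub>S r\<^esub> face_hom \<G> T \<alpha> p r g =
     face_hom \<G> T \<alpha> q r (face_hom \<G> T \<alpha> p q g) \<otimes>\<^bsub>S r\<^esub> face_coh_comp \<G> T \<alpha> p q r"
proof -
  have rp: "r \<subseteq> p" using qp rq by simp
  note i = fc(1)[OF p q r qp rq] fh(1)[OF p r rp g] fh(1)[OF p q qp g] fh(1)[OF q r rq fh(1)[OF
      p q qp g]]
  show ?thesis
  proof (rule S_eqI[OF p r rp])
    fix x assume x: "x \<in> r" "x \<in> p"
    then have xq: "x \<in> q" using rq by auto
    note t = gm_ar[OF p g(1) x(2)] al(2)[OF p q qp xq] al(2)[OF p r rp x(1)] al(2)[OF q r rq
        x(1)] gm_ar[OF r i(1) x(1)] gm_ar[OF r i(2) x(1)] gm_ar[OF q i(3) xq] gm_ar[OF r i(4) x(1)]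
    note e = fh(2)[OF p r rp g x(1)] fh(2)[OF p q qp g xq] fh(2)[OF q r rq i(3) x(1)] fc(2)[OF p q
      r qp rq x(1)]
    let ?c = "gm r (face_coh_comp \<G> T \<alpha> p q r) x"
    have "cmp \<G> (cmp \<G> ?c (gm r (face_hom \<G> T \<alpha> p r g) x)) (\<alpha> p r x) = cmp \<G> ?c (cmp \<G> (\<alpha> p r x)
        (gm p g x))"
      using ar_assoc[OF t(3) t(6) t(5)] e by argo
    also have "\<dots> = cmp \<G> (cmp \<G> (\<alpha> q r x) (\<alpha> p q x)) (gm p g x)"
      using ar_assoc[OF t(1) t(3) t(5)] e by argo
    also have "\<dots> = cmp \<G> (\<alpha> q r x) (cmp \<G> (gm q (face_hom \<G> T \<alpha> p q g) x) (\<alpha> p q x))"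
      using ar_assoc[OF t(1) t(2) t(4)] e by argo
    also have "\<dots> = cmp \<G> (gm r (face_hom \<G> T \<alpha> q r (face_hom \<G> T \<alpha> p q g)) x) (cmp \<G> (\<alpha> q r x)
        (\<alpha> p q x))"
      using ar_assoc[OF t(2) t(7) t(4)] ar_assoc[OF t(2) t(4) t(8)] e by argo
    also have "\<dots> = cmp \<G> (cmp \<G> (gm r (face_hom \<G> T \<alpha> q r (face_hom \<G> T \<alpha> p q g)) x) ?c) (\<alpha> p r x)"
      using ar_assoc[OF t(3) t(5) t(8)] e by argo
    finally show "cmp \<G> (gm r (face_coh_comp \<G> T \<alpha> p q r \<otimes>\<^bsub>S r\<^esub> face_hom \<G> T \<alpha> p r g) x) (\<alpha> p r x) =
      cmp \<G> (gm r (face_hom \<G> T \<alpha> q r (face_hom \<G> T \<alpha> p q g) \<otimes>\<^bsub>S r\<^esub> face_coh_comp \<G> T \<alpha> p q r)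
          x) (\<alpha> p r x)"
      using gm_mult[OF r i(1) i(2) x(1)] gm_mult[OF r i(4) i(1) x(1)] by argo
  qed (use i S_mult_in r in auto)
qed

lemma fi_nat: assumes p: "p \<in> P" and g: "g \<in> carrier (S p)"
  shows "face_coh_id \<G> T \<alpha> p \<otimes>\<^bsub>S p\<^esub> face_hom \<G> T \<alpha> p p g
    = g \<otimes>\<^bsub>S p\<^esub> face_coh_id \<G> T \<alpha> p"
proof (rule S_eqI[OF p p subset_refl])
  fix x assume x: "x \<in> p" "x \<in> p"
  note i = fi(1)[OF p] fh(1)[OF p p subset_refl g]
  note t = gm_ar[OF p g x(1)] al(2)[OF p p subset_refl x(1)] gm_ar[OF p i(1) x(1)] gm_ar[OF p
      i(2) x(1)]
  note e = fi(2)[OF p x(1)] fh(2)[OF p p subset_refl g x(1)]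
  show "cmp \<G> (gm p (face_coh_id \<G> T \<alpha> p \<otimes>\<^bsub>S p\<^esub> face_hom \<G> T \<alpha> p p g) x) (\<alpha> p p x) =
    cmp \<G> (gm p (g \<otimes>\<^bsub>S p\<^esub> face_coh_id \<G> T \<alpha> p) x) (\<alpha> p p x)"
    unfolding gm_mult[OF p i x(1)] gm_mult[OF p g i(1) x(1)]
    unfolding ar_assoc[OF t(2) t(4) t(3), symmetric] e ar_assoc[OF t(2) t(3) t(1), symmetric]
    unfolding ar_assoc[OF t(1) t(2) t(3)] e ar_unt_left[OF t(1)] ar_unt_right[OF t(1)] ..
qed (use assms fi(1) fh S_mult_in in auto)

lemma fc_assoc:
  assumes p: "p \<in> P" and q: "q \<in> P" and r: "r \<in> P" and s: "s \<in> P" and qp: "q \<subseteq> p" and rq: "r \<subseteq>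
      q" and sr: "s \<subseteq> r"
  shows "face_coh_comp \<G> T \<alpha> q r s \<otimes>\<^bsub>S s\<^esub> face_coh_comp \<G> T \<alpha> p q s =
     face_hom \<G> T \<alpha> r s (face_coh_comp \<G> T \<alpha> p q r) \<otimes>\<^bsub>S
       s\<^esub> face_coh_comp \<G> T \<alpha> p r s"
proof -
  have rp: "r \<subseteq> p" and sq: "s \<subseteq> q" and sp: "s \<subseteq> p" using qp rq sr by auto
  note i = fc(1)[OF q r s rq sr] fc(1)[OF p q s qp sq] fc(1)[OF p q r qp rq] fc(1)[OF p r s rp
      sr] fh(1)[OF r s sr fc(1)[OF p q r qp rq]]
  show ?thesis
  proof (rule S_eqI[OF p s sp])
    fix x assume x: "x \<in> s" "x \<in> p"
    then have xq: "x \<in> q" and xr: "x \<in> r" using rq sr by auto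
    note t = al(2)[OF p q qp xq] al(2)[OF q r rq xr] al(2)[OF r s sr x(1)] al(2)[OF p s sp x(1)]
        al(2)[OF q s sq x(1)] al(2)[OF p r rp xr]
    note u = gm_ar[OF s i(1) x(1)] gm_ar[OF s i(2) x(1)] gm_ar[OF r i(3) xr] gm_ar[OF s i(4)
        x(1)] gm_ar[OF s i(5) x(1)]
    note e = fc(2)[OF q r s rq sr x(1)] fc(2)[OF p q s qp sq x(1)] fc(2)[OF p q r qp rq xr]
      fc(2)[OF p r s rp sr x(1)] fh(2)[OF r s sr fc(1)[OF p q r qp rq] x(1)]
    show "cmp \<G> (gm s (face_coh_comp \<G> T \<alpha> q r s \<otimes>\<^bsub>S s\<^esub> face_coh_comp \<G> T \<alpha> p q s) x) (\<alpha> p s x) =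
      cmp \<G> (gm s (face_hom \<G> T \<alpha> r s (face_coh_comp \<G> T \<alpha> p q r) \<otimes>\<^bsub>S s\<^esub> face_coh_comp \<G> T \<alpha> p r
          s) x) (\<alpha> p s x)"
      using gm_mult[OF s i(1,2) x(1)] gm_mult[OF s i(5,4) x(1)]
       ar_assoc[OF t(4) u(2) u(1)] ar_assoc[OF t(4) u(4) u(5)] e
       ar_assoc[OF t(1) t(5) u(1)] ar_assoc[OF t(1) t(2) t(3)]
       ar_assoc[OF t(6) t(3) u(5)] ar_assoc[OF t(6) u(3) t(3)] by argo
  qed (use i S_mult_in s in auto)
qed

lemma unit_right: assumes p: "p \<in> P" and q: "q \<in> P" and qp: "q \<subseteq> p"
  shows "face_hom \<G> T \<alpha> p q (face_coh_id \<G> T \<alpha> p) \<otimes>\<^bsub>S q\<^esub> face_coh_comp \<G> T \<alpha> p p q = \<one>\<^bsub>S q\<^esub>"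
proof -
  note i = fh(1)[OF p q qp fi(1)[OF p]] fc(1)[OF p p q subset_refl qp] fi(1)[OF p]
  show ?thesis
  proof (rule S_eqI[OF p q qp])
    fix x assume x: "x \<in> q" "x \<in> p"
    note t = al(2)[OF p q qp x(1)] al(2)[OF p p subset_refl x(2)]
      gm_ar[OF q i(1) x(1)] gm_ar[OF q i(2) x(1)] gm_ar[OF p i(3) x(2)]
    note e = fh(2)[OF p q qp fi(1)[OF p] x(1)] fc(2)[OF p p q subset_refl qp x(1)] fi(2)[OF p x(2)]
    show "cmp \<G> (gm q (face_hom \<G> T \<alpha> p q (face_coh_id \<G> T \<alpha> p) \<otimes>\<^bsub>S q\<^esub> face_coh_comp \<G> T \<alpha> p p
        q) x) (\<alpha> p q x)
      = cmp \<G> (gm q \<one>\<^bsub>S q\<^esub> x) (\<alpha> p q x)"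
      using gm_mult[OF q i(1,2) x(1)] gm_one[OF q x(1)] e ar_unt_left[OF t(1)] ar_unt_right[OF t(1)]
       ar_assoc[OF t(1) t(4) t(3)] ar_assoc[OF t(2) t(1) t(3)] ar_assoc[OF t(2) t(5) t(1)] by argo
  qed (use i S_mult_in S_one_in q in auto)
qed

lemma unit_left: assumes p: "p \<in> P" and q: "q \<in> P" and qp: "q \<subseteq> p"
  shows "face_coh_id \<G> T \<alpha> q \<otimes>\<^bsub>S q\<^esub> face_coh_comp \<G> T \<alpha> p q q = \<one>\<^bsub>S q\<^esub>"
proof -
  note i = fi(1)[OF q] fc(1)[OF p q q qp subset_refl]
  show ?thesis
  proof (rule S_eqI[OF p q qp])
    fix x assume x: "x \<in> q" "x \<in> p"
    note t = al(2)[OF p q qp x(1)] al(2)[OF q q subset_refl x(1)]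
      gm_ar[OF q i(1) x(1)] gm_ar[OF q i(2) x(1)]
    note e = fc(2)[OF p q q qp subset_refl x(1)] fi(2)[OF q x(1)]
    show "cmp \<G> (gm q (face_coh_id \<G> T \<alpha> q \<otimes>\<^bsub>S q\<^esub> face_coh_comp \<G> T \<alpha> p q q) x) (\<alpha> p q x)
      = cmp \<G> (gm q \<one>\<^bsub>S q\<^esub> x) (\<alpha> p q x)"
      using gm_mult[OF q i(1,2) x(1)] gm_one[OF q x(1)] e ar_unt_left[OF t(1)]
       ar_assoc[OF t(1) t(4) t(3)] ar_assoc[OF t(1) t(2) t(3)] by argo
  qed (use i S_mult_in S_one_in q in auto)
qed

lemma group_cat_category: "group H \<Longrightarrow> category (group_cat H)"
  by unfold_locales (auto simp: group_cat_def group.is_monoid monoid.m_closed monoid.one_closed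
      monoid.l_one monoid.r_one monoid.m_assoc)

lemma iso_S: "p \<in> P \<Longrightarrow> h \<in> carrier (S p) \<Longrightarrow> iso_in (group_cat (S p)) () () h"
  unfolding iso_in_def group_cat_def using S_group[of p] by (auto intro!: bexI[of _ "inv\<^bsub>S p\<^esub>
      h"] simp: group.l_inv group.r_inv group.inv_closed)

theorem complex_of_stabilizers: "complex_of_finite_groups P (\<subseteq>) (stabilizer_complex \<G>
  T \<alpha>)"
proof -
  let ?A = "op_cat (poset_cat P (\<subseteq>))" let ?X = "stabilizer_complex \<G> T \<alpha>"
  have A: "category ?A"
    by unfold_locales (auto simp: op_cat_def poset_cat_def split: if_splits)
  have As: "Ob ?A = P" "Comp ?A a b c g f = ()" "Id ?A a = ()" for a b c g f
    by (simp_all add: op_cat_def poset_cat_def)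
  have Ah: "f \<in> Hom ?A a b \<longleftrightarrow> b \<subseteq> a" for a b f
    by (simp add: op_cat_def poset_cat_def)
  have Xs: "val ?X a = group_cat (S a)" "act_ob ?X a b f x = ()" "act_mor ?X a b f x y =
      face_hom \<G> T \<alpha> a b"
     "coh_comp ?X a b c g f x = face_coh_comp \<G> T \<alpha> a b c" "coh_id ?X a x = face_coh_id \<G> T \<alpha> a"
         for a b c g f x y
    by (simp_all add: stabilizer_complex_def)
  have gs: "Ob (group_cat H) = {()}" "Hom (group_cat H) x y = carrier H" "Id (group_cat H) x = \<one>\<^bsub>H\<^esub>"
     "Comp (group_cat H) x y z g f = g \<otimes>\<^bsub>H\<^esub> f" for H :: "'g monoid" and x y z g f
    by (simp_all add: group_cat_def)
  have "weak_functor ?A ?X"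
    apply (intro weak_functor.intro[OF A] weak_functor_axioms.intro; unfold As Ah Xs)
    subgoal by (rule group_cat_category[OF S_group])
    subgoal by (simp add: is_functor_def gs fh(1) fh_mult fh_one)
    subgoal by (simp add: iso_S fc(1))
    subgoal unfolding gs by (rule fc_nat)
    subgoal by (simp add: iso_S fi(1))
    subgoal unfolding gs by (rule fi_nat)
    subgoal unfolding gs by (rule fc_assoc)
    subgoal unfolding gs by (rule unit_right)
    subgoal unfolding gs by (rule unit_left)
    done
  then show ?thesis unfolding complex_of_finite_groups_def
    using S_group S_finite fh_inj by (auto simp: stabilizer_complex_def group_cat_def)
qed
end

theorem complex_of_finite_groups_stabilizer_complex:
  assumes "orbifold \<G> n M \<pi>" "orbifold_triangulation \<G> M \<pi> T" "chosen_arrows \<G> T \<alpha>"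
  shows "complex_of_finite_groups (simplices T) (\<subseteq>) (stabilizer_complex \<G> T \<alpha>)"
proof -
  interpret triangulated_groupoid \<G> M \<pi> T \<alpha>
    using assms by (intro triangulated_groupoid.intro triangulated_groupoid_axioms.intro
        orbifold.axioms(1))
  show ?thesis by (rule complex_of_stabilizers)
qed

end

theory Submission
  imports Defs
begin

text \<open>
  Every nonempty face of a simplex of the triangulation is again a simplex of it, so the simplices
  below a given simplex are the nonempty subsets of its vertex set. Their alternating count
  \<open>\<Sum> (-1) ^ dim q\<close> is therefore \<open>1\<close>: it is the Euler characteristic of a single simplex, or the vanishing
  of the alternating sum over all subsets of a nonempty finite set. Hence
  \<open>q \<mapsto> (-1) ^ dim q\<close> is a weighting on \<open>P\<^sup>o\<^sup>p\<close>.

  The category of elements of a complex of groups \<open>G\<close> has the same objects as \<open>P\<^sup>o\<^sup>p\<close>, but each arrow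
  \<open>p \<rightarrow> q\<close>, that is each inclusion \<open>q \<subseteq> p\<close>, is replaced by \<open>|G q|\<close> arrows. The number of these depends on
  the target alone, so dividing a weighting on \<open>P\<^sup>o\<^sup>p\<close> by the orders of the groups gives a weighting on
  the category of elements, and its total is the orbifold Euler characteristic.

  That the Euler characteristic is defined requires a coweighting too. Its equations,
  \<open>|G q| \<cdot> \<Sum>\<^bsub>p \<supseteq> q\<^esub> k p = 1\<close> for all \<open>q\<close>, form a triangular system with respect to inclusion, so they can be
  solved. The double count of \<open>\<Sum> k\<^sub>a |Hom a b| k\<^sup>b\<close> shows that every weighting then has the same total,
  so that the weighting found above may be used.
\<close>

section \<open>The total of a weighting\<close>

text \<open>The reason is that both sides are \<open>\<Sum>\<^bsub>a,b\<^esub> l a \<cdot> |Hom a b| \<cdot> k b\<close>.\<close>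

lemma sum_weighting_eq_sum_coweighting:
  assumes k: "weighting C k" and l: "coweighting C l"
  shows "sum k (Ob C) = sum l (Ob C)"
proof -
  have l': "(\<Sum>a\<in>Ob C. of_nat (card (Hom C a b)) * l a) = 1" if "b \<in> Ob C" for b
    using l that by (simp add: coweighting_def weighting_def op_cat_def)
  have k': "(\<Sum>b\<in>Ob C. of_nat (card (Hom C a b)) * k b) = 1" if "a \<in> Ob C" for a
    using k that by (simp add: weighting_def)
  have "sum k (Ob C) = (\<Sum>b\<in>Ob C. (\<Sum>a\<in>Ob C. of_nat (card (Hom C a b)) * l a) * k b)"
    by (simp add: l')
  also have "\<dots> = (\<Sum>b\<in>Ob C. \<Sum>a\<in>Ob C. l a * (of_nat (card (Hom C a b)) * k b))"
    by (simp add: sum_distrib_left sum_distrib_right mult_ac)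
  also have "\<dots> = (\<Sum>a\<in>Ob C. \<Sum>b\<in>Ob C. l a * (of_nat (card (Hom C a b)) * k b))"
    by (rule sum.swap)
  also have "\<dots> = (\<Sum>a\<in>Ob C. l a * (\<Sum>b\<in>Ob C. of_nat (card (Hom C a b)) * k b))"
    by (simp add: sum_distrib_left)
  also have "\<dots> = sum l (Ob C)"
    by (simp add: k')
  finally show ?thesis .
qed

lemma euler_char_eq_sum_weighting:
  assumes "has_euler_char C" and k: "weighting C k"
  shows "euler_char C = sum k (Ob C)"
proof -
  obtain l where "coweighting C l"
    using assms(1) by (auto simp: has_euler_char_def)
  moreover have "weighting C (SOME k. weighting C k)"
    using someI[of "weighting C", OF k] .
  ultimately show ?thesis
    using k by (simp add: euler_char_def sum_weighting_eq_sum_coweighting)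
qed


section \<open>Complexes of finite groups on a finite poset\<close>

text \<open>This is what gives coweightings. The system of equations for \<open>k\<close> is triangular: a minimal
  element can be added last, since its own equation determines \<open>k\<close> there. The resulting \<open>k\<close> is the
  Moebius inversion of \<open>f\<close>.\<close>

lemma ex_sum_above_eq:
  fixes P :: "'a::order set" and f :: "'a \<Rightarrow> 'b::ab_group_add"
  assumes "finite P"
  shows "\<exists>k. \<forall>q\<in>P. (\<Sum>p\<in>{p\<in>P. q \<le> p}. k p) = f q"
  using assms
proof (induction rule: finite_psubset_induct)
  case (psubset P)
  show ?case
  proof (cases "P = {}")
    case False
    then obtain m where m: "m \<in> P" and min: "\<And>q. q \<in> P \<Longrightarrow> q \<le> m \<Longrightarrow> q = m"
      using finite_has_minimal[OF psubset.hyps] by metis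
    obtain k where k: "\<And>q. q \<in> P - {m} \<Longrightarrow> (\<Sum>p\<in>{p \<in> P - {m}. q \<le> p}. k p) = f q"
      using psubset.IH[of "P - {m}"] m by blast
    define k' where "k' = k(m := f m - (\<Sum>p\<in>{p \<in> P - {m}. m \<le> p}. k p))"
    have agree: "sum k' {p \<in> P - {m}. q \<le> p} = sum k {p \<in> P - {m}. q \<le> p}" for q
      by (rule sum.cong) (auto simp: k'_def)
    have "sum k' {p \<in> P. q \<le> p} = f q" if q: "q \<in> P" for q
    proof (cases "q = m")
      case True
      have "{p \<in> P. m \<le> p} = insert m {p \<in> P - {m}. m \<le> p}"
        using m by auto
      with True show ?thesis
        using psubset.hyps by (simp add: agree) (simp add: k'_def)
    next
      case False
      \<comment> \<open>As \<open>m\<close> is minimal, it occurs in no equation but its own.\<close>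
      then have "{p \<in> P. q \<le> p} = {p \<in> P - {m}. q \<le> p}"
        using min[OF q] by auto
      with False q show ?thesis
        using k[of q] by (simp only: agree) simp
    qed
    then show ?thesis by blast
  qed simp
qed

lemma Ob_elements_complex_of_groups:
  assumes "complex_of_finite_groups P below G"
  shows "Ob (elements (op_cat (poset_cat P below)) G) = (\<lambda>p. (p, ())) ` P"
proof -
  have "Ob (val G p) = {()}" if "p \<in> P" for p
    using assms that by (auto simp: complex_of_finite_groups_def group_cat_def)
  then show ?thesis
    by (auto simp: elements_simps op_cat_def poset_cat_def)
qed

text \<open>The number of arrows into \<open>q\<close> does not depend on where they start, as long as there are
  any.\<close>

lemma Hom_elements_complex_of_groups:
  fixes G :: "('a, unit, unit, 'g) cat_valued"
  shows "Hom (elements (op_cat (poset_cat P below)) G) (p, ()) (q, ())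
    = (if below q p then Pair () ` Hom (val G q) () () else {})"
  by (auto simp: elements_simps op_cat_def poset_cat_def split: if_splits)

lemma euler_char_elements_complex_of_groups:
  fixes P :: "'a::order set" and G :: "('a, unit, unit, 'g) cat_valued"
  assumes G: "complex_of_finite_groups P (\<le>) G" and fin: "finite P"
    and e: "\<And>p. p \<in> P \<Longrightarrow> (\<Sum>q\<in>{q\<in>P. q \<le> p}. e q) = 1"
  defines "E \<equiv> elements (op_cat (poset_cat P (\<le>))) G"
  shows "has_euler_char E"
    and "euler_char E = (\<Sum>p\<in>P. e p / of_nat (card (Hom (val G p) () ())))"
proof -
  define N :: "'a \<Rightarrow> rat" where "N p = of_nat (card (Hom (val G p) () ()))" for p
  have Hom_fin: "finite (Hom (val G p) () ())" and N0: "N p \<noteq> 0" if p: "p \<in> P" for p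
  proof -
    obtain H :: "'g monoid" where H: "group H" "finite (carrier H)" "val G p = group_cat H"
      using G p by (auto simp: complex_of_finite_groups_def)
    have "\<one>\<^bsub>H\<^esub> \<in> carrier H"
      using H(1) by (simp add: group.is_monoid monoid.one_closed)
    with H show "finite (Hom (val G p) () ())" "N p \<noteq> 0"
      by (auto simp: N_def group_cat_def)
  qed
  have Ob: "Ob E = (\<lambda>p. (p, ())) ` P"
    unfolding E_def by (rule Ob_elements_complex_of_groups[OF G])
  have sum_Ob: "(\<Sum>x\<in>Ob E. h x) = (\<Sum>p\<in>P. h (p, ()))" for h :: "'a \<times> unit \<Rightarrow> rat"
    unfolding Ob by (subst sum.reindex) (auto intro: inj_onI)
  have card_Hom: "of_nat (card (Hom E (p, ()) (q, ()))) = (if q \<le> p then N q else 0)" for p q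
    by (simp add: E_def Hom_elements_complex_of_groups N_def card_image inj_on_def)

  have fincat: "finite_category E"
    unfolding finite_category_def
  proof (intro conjI ballI)
    show "category E"
      using G weak_functor.category_elements unfolding E_def complex_of_finite_groups_def by blast
    show "finite (Ob E)"
      using fin by (simp add: Ob)
    show "finite (Hom E a b)" if "a \<in> Ob E" "b \<in> Ob E" for a b
      using that Hom_fin by (auto simp: Ob) (simp add: E_def Hom_elements_complex_of_groups)
  qed

  have weight: "weighting E (\<lambda>(p, _). e p / N p)"
    unfolding weighting_def
  proof
    fix a assume "a \<in> Ob E"
    then obtain p where a: "a = (p, ())" and p: "p \<in> P" by (auto simp: Ob)
    have "(\<Sum>q\<in>P. (if q \<le> p then N q else 0) * (e q / N q)) = (\<Sum>q\<in>{q\<in>P. q \<le> p}. e q)"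
      using fin N0 by (intro sum.mono_neutral_cong_right) auto
    then show "(\<Sum>b\<in>Ob E. of_nat (card (Hom E a b)) * (case b of (p, _) \<Rightarrow> e p / N p)) = 1"
      by (simp add: a sum_Ob card_Hom e[OF p])
  qed

  obtain k where k: "\<And>q. q \<in> P \<Longrightarrow> (\<Sum>p\<in>{p\<in>P. q \<le> p}. k p) = 1 / N q"
    using ex_sum_above_eq[OF fin, of "\<lambda>q. 1 / N q"] by blast
  have coweight: "coweighting E (\<lambda>(p, _). k p)"
    unfolding coweighting_def weighting_def
  proof
    fix b assume "b \<in> Ob (op_cat E)"
    then obtain q where b: "b = (q, ())" and q: "q \<in> P" by (auto simp: op_cat_def Ob)
    have "(\<Sum>p\<in>P. (if q \<le> p then N q else 0) * k p) = (\<Sum>p\<in>{p\<in>P. q \<le> p}. N q * k p)"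
      using fin by (intro sum.mono_neutral_cong_right) auto
    also have "\<dots> = 1"
      using k[OF q] N0[OF q] by (simp flip: sum_distrib_left)
    finally show "(\<Sum>a\<in>Ob (op_cat E). of_nat (card (Hom (op_cat E) b a)) * (case a of (p, _) \<Rightarrow> k p)) = 1"
      by (simp add: b op_cat_def sum_Ob card_Hom)
  qed

  show E: "has_euler_char E"
    using fincat weight coweight unfolding has_euler_char_def by blast
  show "euler_char E = (\<Sum>p\<in>P. e p / of_nat (card (Hom (val G p) () ())))"
    unfolding euler_char_eq_sum_weighting[OF E weight] sum_Ob by (simp add: N_def)
qed


section \<open>The faces of a simplex\<close>

text \<open>A simplex determines its vertices, as they are its extreme points.\<close>

lemma inj_on_convex_hull_affine_independent:
  fixes C :: "'e::euclidean_space set"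
  assumes "\<not> affine_dependent C"
  shows "inj_on ((hull) convex) (Pow C)"
proof (rule inj_onI)
  fix c d assume c: "c \<in> Pow C" and d: "d \<in> Pow C" and eq: "convex hull c = convex hull d"
  have "{x. x extreme_point_of (convex hull b)} = b" if "b \<in> Pow C" for b
    using affine_independent_subset[OF assms, of b] that
    by (simp add: extreme_point_of_convex_hull_affine_independent)
  then show "c = d"
    using c d eq by metis
qed

lemma sum_alternating_faces_simplex:
  fixes S :: "'e::euclidean_space set"
  assumes S: "n simplex S" and ne: "S \<noteq> {}"
  shows "(\<Sum>F | F face_of S \<and> F \<noteq> {}. (-1) ^ nat (aff_dim F)) = (1 :: 'a::comm_ring_1)"
proof -
  obtain C where C: "\<not> affine_dependent C" "S = convex hull C"
    using S by (auto simp: simplex_def)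
  have fin: "finite C" and C0: "C \<noteq> {}"
    using C ne aff_independent_finite by auto
  have faces: "{F. F face_of S \<and> F \<noteq> {}} = (hull) convex ` (Pow C - {{}})"
    using face_of_convex_hull_affine_independent[OF C(1)] C(2) by auto
  have dim: "(-1) ^ nat (aff_dim (convex hull c)) = - ((-1) ^ card c :: 'a)"
    if "c \<in> Pow C - {{}}" for c
  proof -
    have c: "\<not> affine_dependent c" "c \<noteq> {}"
      using that affine_independent_subset[OF C(1)] by auto
    then have "card c > 0"
      using aff_independent_finite by (simp add: card_gt_0_iff)
    then have "card c = Suc (nat (aff_dim c))"
      using aff_dim_affine_independent[OF c(1)] by linarith
    then show ?thesis
      by (simp add: aff_dim_convex_hull)
  qed
  \<comment> \<open>The expansion of the product \<open>\<Prod>x\<in>C. (1 - 1)\<close>, which vanishes as \<open>C\<close> is nonempty.\<close>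
  have "(\<Sum>c\<in>Pow C. (-1) ^ card c) = (0 :: 'a)"
    using prod_diff_conv_sum[OF fin, of "\<lambda>_. 1 :: 'a" "\<lambda>_. 1"] fin C0
    by (simp add: zero_power card_gt_0_iff)
  then have all: "(\<Sum>c\<in>Pow C - {{}}. - ((-1) ^ card c)) = (1 :: 'a)"
    using fin by (simp add: sum_negf sum_diff1)
  have inj: "inj_on ((hull) convex) (Pow C - {{}})"
    using inj_on_convex_hull_affine_independent[OF C(1)] by (rule inj_on_subset) auto
  show ?thesis
    unfolding faces sum.reindex[OF inj] o_def using dim all by simp
qed

text \<open>An included cell is its own intersection with the larger one, and cells meet in common
  faces. This identifies the order on the simplices of a triangulation with the face relation.\<close>

lemma simplicial_complex_subset_iff_face_of:
  assumes K: "simplicial_complex K" and p: "p \<in> K"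
  shows "q \<in> K \<and> q \<subseteq> p \<longleftrightarrow> q face_of p"
proof
  assume q: "q \<in> K \<and> q \<subseteq> p"
  then have "p \<inter> q face_of p"
    using K p unfolding simplicial_complex_def by blast
  with q show "q face_of p"
    by (simp add: Int_absorb1)
next
  assume "q face_of p"
  then show "q \<in> K \<and> q \<subseteq> p"
    using K p face_of_imp_subset unfolding simplicial_complex_def by blast
qed

lemma sum_alternating_below_simplex:
  assumes K: "simplicial_complex K" and p: "p \<in> K - {{}}"
  shows "(\<Sum>q\<in>{q \<in> K - {{}}. q \<subseteq> p}. (-1) ^ nat (aff_dim q)) = (1 :: 'a::comm_ring_1)"
proof -
  obtain n where n: "n simplex p"
    using K p unfolding simplicial_complex_def by blast
  have "{q \<in> K - {{}}. q \<subseteq> p} = {q. q face_of p \<and> q \<noteq> {}}"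
    using simplicial_complex_subset_iff_face_of[OF K, of p] p by blast
  then show ?thesis
    using sum_alternating_faces_simplex[OF n] p by simp
qed


section \<open>Triangulated orbifolds\<close>

theorem proposition2p12:
  fixes \<G> :: "('o, 'a) top_groupoid"
    and n :: nat
    and M :: "'m topology"
    and \<pi> :: "'o \<Rightarrow> 'm"
    and T :: "('o, 'a, 'g, 'e::euclidean_space, 'm) triang"
    and \<alpha> :: "'e set \<Rightarrow> 'e set \<Rightarrow> 'e \<Rightarrow> 'a"
  assumes "orbifold \<G> n M \<pi>"
    and "compact_space M"
    and "orbifold_triangulation \<G> M \<pi> T"
    and "chosen_arrows \<G> T \<alpha>"
  shows "let P = poset_cat (simplices T) (\<subseteq>); G = stabilizer_complex \<G> T \<alpha>
         in has_euler_char (elements (op_cat P) G) \<and>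
            euler_char (elements (op_cat P) G) = orbifold_euler_char \<G> T"
proof -
  define P where "P = simplices T"
  define G where "G = stabilizer_complex \<G> T \<alpha>"
  define e :: "'e set \<Rightarrow> rat" where "e p = (-1) ^ nat (aff_dim p)" for p
  have K: "simplicial_complex (cplx T)"
    using assms(3) by (rule orbifold_triangulation.complex)
  have G: "complex_of_finite_groups P (\<subseteq>) G"
    unfolding P_def G_def
    using assms by (intro complex_of_finite_groups_stabilizer_complex)
  have fin: "finite P"
    using K by (simp add: P_def simplices_def simplicial_complex_def)
  have e: "(\<Sum>q\<in>{q\<in>P. q \<subseteq> p}. e q) = 1" if "p \<in> P" for p
    using sum_alternating_below_simplex[OF K] that by (simp add: P_def simplices_def e_def)
  have "(\<Sum>p\<in>P. e p / of_nat (card (Hom (val G p) () ()))) = orbifold_euler_char \<G> T"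
    by (simp add: orbifold_euler_char_def P_def G_def e_def stabilizer_complex_def group_cat_def)
  then show ?thesis
    using euler_char_elements_complex_of_groups[OF G fin e]
    by (simp add: Let_def P_def G_def)
qed

end
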